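(* Let $n\ge1$ be an integer and let $\alpha,\beta\in\mathbb R$ with $\alpha\ne-\frac1{2n}$ and $\beta\neq0$. Equip $\Xi_n$ with the (semi-)Riemannian metric $$g_{D,u}((X,x),(Y,y))=\frac12\operatorname{Tr}(D^{-1}XD^{-1}Y)+\alpha\operatorname{Tr}(D^{-1}X)\operatorname{Tr}(D^{-1}Y)+\beta\langle x,Dy\rangle.$$ For every $(D,u)\in\Xi_n$ and all tangent vectors $(X,x),(Y,y)\in\mathrm T_n$, the Ricci curvature tensor is $$\mathrm{Ric}_{(D,u)}((X,x),(Y,y))=-\frac{n+1}4\operatorname{Tr}(D^{-1}XD^{-1}Y)+\frac14\operatorname{Tr}(D^{-1}X)\operatorname{Tr}(D^{-1}Y)-\frac{\beta}{2(1+2n\alpha)}\langle x,Dy\rangle.$$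
   Context: $\Xi_n=\mathcal M_n\times\mathbb R^n$, where $\mathcal M_n$ is the set of real symmetric strictly positive definite $n\times n$ matrices. $\Xi_n$ is an open subset of the vector space $\mathrm T_n=M_n\times\mathbb R^n$ ($M_n$ = real symmetric $n\times n$ matrices), so the tangent space at each point is $\mathrm T_n$. Conventions: with $\nabla$ the Levi-Civita connection of $g$, $R(\xi,\eta,\zeta)=R(\xi,\eta)\zeta$ where $R(\xi,\eta)=[\nabla_\xi,\nabla_\eta]-\nabla_{[\xi,\eta]}$. The Ricci tensor is $\mathrm{Ric}_{(D,u)}(\xi,\eta)=\operatorname{Tr}\left(\zeta\mapsto R_{(D,u)}(\zeta,\xi,\eta)\right)$, the trace of a linear map on $\mathrm T_n$. *)

theory Defs
  imports "HOL-Analysis.Analysis"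
begin

typedef 'n sym_matrix = "{A :: real ^ 'n ^ 'n::finite. transpose A = A}"
  morphisms of_sym to_sym
  by (rule exI[of _ 0]) (simp add: transpose_def vec_eq_iff)

lemma transpose_of_sym [simp]: "transpose (of_sym A) = of_sym A"
  using of_sym[of A] by simp

lemma of_sym_to_sym: "transpose A = A \<Longrightarrow> of_sym (to_sym A) = A"
  by (simp add: to_sym_inverse)

lemma sym_matrix_eq_iff: "A = B \<longleftrightarrow> of_sym A = of_sym B"
  by (simp add: of_sym_inject)

instantiation sym_matrix :: (finite) real_inner
begin

definition "(0 :: 'a sym_matrix) = to_sym 0"
definition "(A :: 'a sym_matrix) + B = to_sym (of_sym A + of_sym B)"
definition "(A :: 'a sym_matrix) - B = to_sym (of_sym A - of_sym B)"
definition "- (A :: 'a sym_matrix) = to_sym (- of_sym A)"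
definition "c *\<^sub>R (A :: 'a sym_matrix) = to_sym (c *\<^sub>R of_sym A)"
definition "(A :: 'a sym_matrix) \<bullet> B = of_sym A \<bullet> of_sym B"
definition "norm (A :: 'a sym_matrix) = norm (of_sym A)"
definition "dist (A :: 'a sym_matrix) B = dist (of_sym A) (of_sym B)"
definition "sgn (A :: 'a sym_matrix) = inverse (norm A) *\<^sub>R A"
definition "(uniformity :: ('a sym_matrix \<times> 'a sym_matrix) filter) =
  (INF e\<in>{0<..}. principal {(A, B). dist A B < e})"
definition "open (U :: 'a sym_matrix set) \<longleftrightarrow>
  (\<forall>A\<in>U. \<forall>\<^sub>F (A', B) in uniformity. A' = A \<longrightarrow> B \<in> U)"

lemma of_sym_zero [simp]: "of_sym 0 = 0"
  unfolding zero_sym_matrix_def by (rule of_sym_to_sym) (simp add: transpose_def vec_eq_iff)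

lemma of_sym_add [simp]: "of_sym (A + B) = of_sym A + of_sym B"
  unfolding plus_sym_matrix_def
  using of_sym[of A] of_sym[of B]
  by (intro of_sym_to_sym) (simp add: transpose_def vec_eq_iff)

lemma of_sym_diff [simp]: "of_sym (A - B) = of_sym A - of_sym B"
  unfolding minus_sym_matrix_def
  using of_sym[of A] of_sym[of B]
  by (intro of_sym_to_sym) (simp add: transpose_def vec_eq_iff)

lemma of_sym_minus [simp]: "of_sym (- A) = - of_sym A"
  unfolding uminus_sym_matrix_def
  using of_sym[of A]
  by (intro of_sym_to_sym) (simp add: transpose_def vec_eq_iff)

lemma of_sym_scaleR [simp]: "of_sym (c *\<^sub>R A) = c *\<^sub>R of_sym A"
  unfolding scaleR_sym_matrix_def
  using of_sym[of A]
  by (intro of_sym_to_sym) (simp add: transpose_def vec_eq_iff)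

instance
proof
  fix A B C :: "'a sym_matrix" and a b :: real
  show "A + B + C = A + (B + C)" "A + B = B + A" "0 + A = A" "- A + A = 0" "A - B = A + - B"
    "a *\<^sub>R (A + B) = a *\<^sub>R A + a *\<^sub>R B" "(a + b) *\<^sub>R A = a *\<^sub>R A + b *\<^sub>R A"
    "a *\<^sub>R b *\<^sub>R A = (a * b) *\<^sub>R A" "1 *\<^sub>R A = A"
    by (simp_all add: sym_matrix_eq_iff algebra_simps)
  show "dist A B = norm (A - B)"
    by (simp add: dist_sym_matrix_def norm_sym_matrix_def dist_norm)
  show "A \<bullet> B = B \<bullet> A" "(A + B) \<bullet> C = A \<bullet> C + B \<bullet> C" "(a *\<^sub>R A) \<bullet> B = a * (A \<bullet> B)"
    "0 \<le> A \<bullet> A" "(A \<bullet> A = 0) = (A = 0)" "norm A = sqrt (A \<bullet> A)"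
    by (simp_all add: inner_sym_matrix_def norm_sym_matrix_def sym_matrix_eq_iff
        norm_eq_sqrt_inner inner_add_left inner_commute[of "of_sym A" "of_sym B"])
qed (fact sgn_sym_matrix_def uniformity_sym_matrix_def open_sym_matrix_def)+

end

text \<open>The orthonormal family consisting of \<open>E\<^sub>i\<^sub>i\<close> and \<open>(E\<^sub>i\<^sub>j + E\<^sub>j\<^sub>i) / \<surd>2\<close> for \<open>i \<noteq> j\<close>,
  where \<open>i, j\<close> and \<open>j, i\<close> give the same element.\<close>

definition sym_unit :: "'n::finite \<Rightarrow> 'n \<Rightarrow> 'n sym_matrix" where
  "sym_unit i j = to_sym (\<chi> k l. if {k, l} = {i, j} then (if i = j then 1 else 1 / sqrt 2) else 0)"

lemma of_sym_sym_unit: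
  "of_sym (sym_unit i j) =
    (\<chi> k l. if {k, l} = {i, j} then (if i = j then 1 else 1 / sqrt 2) else 0)"
  unfolding sym_unit_def
  by (rule of_sym_to_sym) (simp add: transpose_def vec_eq_iff insert_commute)

lemma inner_sym_unit:
  "A \<bullet> sym_unit i j = (if i = j then 1 else sqrt 2) * of_sym A $ i $ j"
proof -
  have sym: "of_sym A $ j $ i = of_sym A $ i $ j"
    using of_sym[of A] by (simp add: transpose_def vec_eq_iff)
  define c :: real where "c = (if i = j then 1 else 1 / sqrt 2)"
  have "A \<bullet> sym_unit i j = (\<Sum>k\<in>UNIV. \<Sum>l\<in>UNIV. of_sym A $ k $ l * (if {k, l} = {i, j} then c else 0))"
    unfolding inner_sym_matrix_def inner_vec_def of_sym_sym_unit c_def by (simp cong: if_cong)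
  also have "\<dots> = (\<Sum>p\<in>UNIV. if {fst p, snd p} = {i, j} then of_sym A $ fst p $ snd p * c else 0)"
    by (simp add: sum.cartesian_product case_prod_unfold if_distrib cong: if_cong)
  also have "\<dots> = (\<Sum>p\<in>{(i, j), (j, i)}. of_sym A $ fst p $ snd p * c)"
    by (rule sum.mono_neutral_cong_right) (auto simp: doubleton_eq_iff)
  also have "\<dots> = (if i = j then 1 else sqrt 2) * of_sym A $ i $ j"
    by (auto simp: c_def sym real_div_sqrt field_simps)
  finally show ?thesis .
qed

instantiation sym_matrix :: (finite) euclidean_space
begin

definition "(Basis :: 'a sym_matrix set) = (\<Union>i j. {sym_unit i j})"

instance
proof
  show "(Basis :: 'a sym_matrix set) \<noteq> {}" and "finite (Basis :: 'a sym_matrix set)"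
    by (auto simp: Basis_sym_matrix_def)
next
  fix A B :: "'a sym_matrix" assume "A \<in> Basis" "B \<in> Basis"
  then obtain i j k l where AB: "A = sym_unit i j" "B = sym_unit k l"
    by (auto simp: Basis_sym_matrix_def)
  show "A \<bullet> B = (if A = B then 1 else 0)"
  proof (cases "{i, j} = {k, l}")
    case True
    then have "(i = j) = (k = l)" by (auto simp: doubleton_eq_iff)
    with True have "A = B" unfolding AB sym_unit_def by simp
    then show ?thesis by (simp add: AB inner_sym_unit of_sym_sym_unit)
  next
    case False
    then have "A \<bullet> B = 0" by (auto simp: AB inner_sym_unit of_sym_sym_unit)
    moreover have "A \<bullet> A = 1" by (simp add: AB inner_sym_unit of_sym_sym_unit)
    ultimately show ?thesis by auto
  qed
next
  fix A :: "'a sym_matrix"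
  show "(\<forall>B\<in>Basis. A \<bullet> B = 0) = (A = 0)"
    by (auto simp: Basis_sym_matrix_def inner_sym_unit sym_matrix_eq_iff vec_eq_iff split: if_splits)
qed

end

text \<open>In the following \<open>S\<close> is an open subset of a Euclidean space, all tangent spaces are identified
  with the ambient vector space, and vector fields on \<open>S\<close> are functions that are smooth on \<open>S\<close>; their
  values outside \<open>S\<close> are irrelevant. The inner product of the type class only provides the topology; it is unrelated
  to the metric \<open>g\<close>.\<close>

primrec Ck_on :: "nat \<Rightarrow> ('a::euclidean_space \<Rightarrow> 'b::real_normed_vector) \<Rightarrow> 'a set \<Rightarrow> bool" where
  "Ck_on 0 f S \<longleftrightarrow> continuous_on S f"
| "Ck_on (Suc k) f S \<longleftrightarrow>
    f differentiable_on S \<and> (\<forall>v. Ck_on k (\<lambda>p. frechet_derivative f (at p) v) S)"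

definition smooth_on :: "('a::euclidean_space \<Rightarrow> 'b::real_normed_vector) \<Rightarrow> 'a set \<Rightarrow> bool" where
  "smooth_on f S \<longleftrightarrow> (\<forall>k. Ck_on k f S)"

definition dir_deriv ::
  "('a::euclidean_space \<Rightarrow> 'a) \<Rightarrow> ('a \<Rightarrow> 'b::real_normed_vector) \<Rightarrow> 'a \<Rightarrow> 'b" where
  "dir_deriv \<xi> f = (\<lambda>p. frechet_derivative f (at p) (\<xi> p))"

definition lie_bracket :: "('a::euclidean_space \<Rightarrow> 'a) \<Rightarrow> ('a \<Rightarrow> 'a) \<Rightarrow> 'a \<Rightarrow> 'a" where
  "lie_bracket \<xi> \<eta> = (\<lambda>p. dir_deriv \<xi> \<eta> p - dir_deriv \<eta> \<xi> p)"

type_synonym 'a connection = "('a \<Rightarrow> 'a) \<Rightarrow> ('a \<Rightarrow> 'a) \<Rightarrow> 'a \<Rightarrow> 'a"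

definition affine_connection_on :: "'a::euclidean_space set \<Rightarrow> 'a connection \<Rightarrow> bool" where
  "affine_connection_on S nabla \<longleftrightarrow>
    (\<forall>\<xi> \<eta>. smooth_on \<xi> S \<longrightarrow> smooth_on \<eta> S \<longrightarrow> smooth_on (nabla \<xi> \<eta>) S) \<and>
    (\<forall>\<xi> \<xi>' \<eta>. smooth_on \<xi> S \<longrightarrow> smooth_on \<xi>' S \<longrightarrow> smooth_on \<eta> S \<longrightarrow>
      (\<forall>p\<in>S. nabla (\<lambda>q. \<xi> q + \<xi>' q) \<eta> p = nabla \<xi> \<eta> p + nabla \<xi>' \<eta> p)) \<and>
    (\<forall>f \<xi> \<eta>. smooth_on f S \<longrightarrow> smooth_on \<xi> S \<longrightarrow> smooth_on \<eta> S \<longrightarrow>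
      (\<forall>p\<in>S. nabla (\<lambda>q. f q *\<^sub>R \<xi> q) \<eta> p = f p *\<^sub>R nabla \<xi> \<eta> p)) \<and>
    (\<forall>\<xi> \<eta> \<eta>'. smooth_on \<xi> S \<longrightarrow> smooth_on \<eta> S \<longrightarrow> smooth_on \<eta>' S \<longrightarrow>
      (\<forall>p\<in>S. nabla \<xi> (\<lambda>q. \<eta> q + \<eta>' q) p = nabla \<xi> \<eta> p + nabla \<xi> \<eta>' p)) \<and>
    (\<forall>(f :: 'a \<Rightarrow> real) \<xi> \<eta>. smooth_on f S \<longrightarrow> smooth_on \<xi> S \<longrightarrow> smooth_on \<eta> S \<longrightarrow>
      (\<forall>p\<in>S. nabla \<xi> (\<lambda>q. f q *\<^sub>R \<eta> q) p = dir_deriv \<xi> f p *\<^sub>R \<eta> p + f p *\<^sub>R nabla \<xi> \<eta> p))"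

definition torsion_free_on :: "'a::euclidean_space set \<Rightarrow> 'a connection \<Rightarrow> bool" where
  "torsion_free_on S nabla \<longleftrightarrow>
    (\<forall>\<xi> \<eta>. smooth_on \<xi> S \<longrightarrow> smooth_on \<eta> S \<longrightarrow>
      (\<forall>p\<in>S. nabla \<xi> \<eta> p - nabla \<eta> \<xi> p = lie_bracket \<xi> \<eta> p))"

definition metric_compatible_on ::
  "'a::euclidean_space set \<Rightarrow> ('a \<Rightarrow> 'a \<Rightarrow> 'a \<Rightarrow> real) \<Rightarrow> 'a connection \<Rightarrow> bool" where
  "metric_compatible_on S g nabla \<longleftrightarrow>
    (\<forall>\<xi> \<eta> \<zeta>. smooth_on \<xi> S \<longrightarrow> smooth_on \<eta> S \<longrightarrow> smooth_on \<zeta> S \<longrightarrow>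
      (\<forall>p\<in>S. dir_deriv \<xi> (\<lambda>q. g q (\<eta> q) (\<zeta> q)) p =
        g p (nabla \<xi> \<eta> p) (\<zeta> p) + g p (\<eta> p) (nabla \<xi> \<zeta> p)))"

definition is_levi_civita_on ::
  "'a::euclidean_space set \<Rightarrow> ('a \<Rightarrow> 'a \<Rightarrow> 'a \<Rightarrow> real) \<Rightarrow> 'a connection \<Rightarrow> bool" where
  "is_levi_civita_on S g nabla \<longleftrightarrow>
    affine_connection_on S nabla \<and> torsion_free_on S nabla \<and> metric_compatible_on S g nabla"

text \<open>For a semi-Riemannian metric \<open>g\<close> the conditions determine \<open>nabla \<xi> \<eta>\<close> on \<open>S\<close> for all vector fields
  \<open>\<xi>, \<eta>\<close> on \<open>S\<close>; the choice operator is needed only because \<open>nabla \<xi> \<eta>\<close> is unspecified for functions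
  that are not smooth on \<open>S\<close>, and outside \<open>S\<close>.\<close>

definition levi_civita :: "'a::euclidean_space set \<Rightarrow> ('a \<Rightarrow> 'a \<Rightarrow> 'a \<Rightarrow> real) \<Rightarrow> 'a connection" where
  "levi_civita S g = (SOME nabla. is_levi_civita_on S g nabla)"

definition curvature ::
  "'a::euclidean_space connection \<Rightarrow> ('a \<Rightarrow> 'a) \<Rightarrow> ('a \<Rightarrow> 'a) \<Rightarrow> ('a \<Rightarrow> 'a) \<Rightarrow> 'a \<Rightarrow> 'a" where
  "curvature nabla \<xi> \<eta> \<zeta> =
    (\<lambda>p. nabla \<xi> (nabla \<eta> \<zeta>) p - nabla \<eta> (nabla \<xi> \<zeta>) p - nabla (lie_bracket \<xi> \<eta>) \<zeta> p)"

text \<open>The curvature is tensorial, so its value on tangent vectors at \<open>p\<close> may be computed with any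
  vector fields extending them; the constant ones are used here.\<close>

definition riemann_tensor ::
  "'a::euclidean_space set \<Rightarrow> ('a \<Rightarrow> 'a \<Rightarrow> 'a \<Rightarrow> real) \<Rightarrow> 'a \<Rightarrow> 'a \<Rightarrow> 'a \<Rightarrow> 'a \<Rightarrow> 'a" where
  "riemann_tensor S g p v w z = curvature (levi_civita S g) (\<lambda>_. v) (\<lambda>_. w) (\<lambda>_. z) p"

text \<open>The trace of a linear endomorphism, computed in the orthonormal basis of the type; as always,
  it does not depend on the basis.\<close>

definition linear_trace :: "('a::euclidean_space \<Rightarrow> 'a) \<Rightarrow> real" where
  "linear_trace L = (\<Sum>b\<in>Basis. L b \<bullet> b)"

definition ricci_tensor ::
  "'a::euclidean_space set \<Rightarrow> ('a \<Rightarrow> 'a \<Rightarrow> 'a \<Rightarrow> real) \<Rightarrow> 'a \<Rightarrow> 'a \<Rightarrow> 'a \<Rightarrow> real" where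
  "ricci_tensor S g p v w = linear_trace (\<lambda>z. riemann_tensor S g p z v w)"

definition pos_def :: "'n::finite sym_matrix \<Rightarrow> bool" where
  "pos_def D \<longleftrightarrow> (\<forall>x. x \<noteq> 0 \<longrightarrow> x \<bullet> (of_sym D *v x) > 0)"

definition Xi :: "('n::finite sym_matrix \<times> (real ^ 'n)) set" where
  "Xi = {D. pos_def D} \<times> UNIV"

abbreviation inv_sym :: "'n::finite sym_matrix \<Rightarrow> real ^ 'n ^ 'n" where
  "inv_sym D \<equiv> matrix_inv (of_sym D)"

definition Xi_metric :: "real \<Rightarrow> real \<Rightarrow> 'n::finite sym_matrix \<times> (real ^ 'n) \<Rightarrow>
    'n sym_matrix \<times> (real ^ 'n) \<Rightarrow> 'n sym_matrix \<times> (real ^ 'n) \<Rightarrow> real" where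
  "Xi_metric \<alpha> \<beta> = (\<lambda>(D, u) (X, x) (Y, y).
      1 / 2 * trace (inv_sym D ** of_sym X ** inv_sym D ** of_sym Y)
    + \<alpha> * trace (inv_sym D ** of_sym X) * trace (inv_sym D ** of_sym Y)
    + \<beta> * (x \<bullet> (of_sym D *v y)))"

end

theory Submission
  imports Defs
begin

text \<open>
  Write \<open>n\<close> for the size of the matrices, \<open>P = D\<^sup>-\<^sup>1\<close>, \<open>v = (X, x)\<close> and \<open>w = (Y, y)\<close>. Since the
  domain is open in a vector space, the Levi-Civita connection is \<open>\<nabla>\<^sub>\<xi> \<eta> = D\<eta>(\<xi>) + \<Gamma>(\<xi>, \<eta>)\<close> for a
  field \<open>\<Gamma>\<close> of symmetric bilinear maps, and solving the Koszul formula for constant fields gives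

  \<open>\<Gamma>(v, w) = (- (X P Y + Y P X) / 2 - (\<beta> / 2) D (x y\<^sup>T + y x\<^sup>T) D + c \<langle>x, D y\<rangle> D, P (X y + Y x) / 2)\<close>

  with \<open>c = 2\<alpha>\<beta> / (1 + 2n\<alpha>)\<close>. That this is the connection follows from its compatibility with the
  metric (\<open>Xi_metric_has_derivative\<close>), its symmetry, and the uniqueness of such a connection for a
  nondegenerate metric (\<open>levi_civita_eq_chart_nabla\<close>, \<open>Xi_metric_nondegenerate\<close>). Existence also
  requires that \<open>\<Gamma>\<close> maps smooth fields to smooth fields, hence that the matrix inverse is smooth
  (\<open>smooth_on_matrix_inv\<close>).

  For constant fields the curvature is a quadratic expression in \<open>\<Gamma>\<close> plus derivatives of \<open>\<Gamma>\<close>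
  (\<open>riemann_tensor_eq\<close>), and its trace splits into four traces:

  \<open>Ric(v, w) = Tr(z \<mapsto> \<partial>\<^sub>z \<Gamma>(v, w)) - Tr(z \<mapsto> \<partial>\<^sub>v \<Gamma>(z, w)) + Tr(z \<mapsto> \<Gamma>(z, \<Gamma>(v, w))) - Tr(z \<mapsto> \<Gamma>(v, \<Gamma>(z, w)))\<close>.

  Each is a sum over symmetric matrices and a sum over vectors. The vector sums are ordinary matrix
  traces. The sums over symmetric matrices reduce to one identity: for an orthonormal basis \<open>b\<close> of the
  symmetric matrices, \<open>\<Sum>\<^sub>b \<langle>A b B, b\<rangle> = (Tr A Tr B + \<langle>A, B\<rangle>) / 2\<close>
  (\<open>sum_Basis_sym_matrix_sandwich\<close>). Adding up, the terms quadratic in \<open>n\<close> cancel and the coefficient of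
  \<open>\<langle>x, D y\<rangle>\<close> is \<open>(n c - \<beta>) / 2 = - \<beta> / (2 (1 + 2n\<alpha>))\<close>.
\<close>

section \<open>Smooth functions\<close>

lemma differentiable_on_has_derivative:
  assumes "f differentiable_on S" "open S" "p \<in> S"
  shows "(f has_derivative frechet_derivative f (at p)) (at p)"
  using assms by (auto simp: differentiable_on_eq_differentiable_at frechet_derivative_works)

lemma Ck_on_cong:
  assumes "open S" "\<forall>p\<in>S. f p = g p" "Ck_on k f S"
  shows "Ck_on k g S"
  using assms(2,3)
proof (induction k arbitrary: f g)
  case 0
  then show ?case using continuous_on_cong by fastforce
next
  case (Suc k)
  have der: "(g has_derivative frechet_derivative f (at p)) (at p)" if "p \<in> S" for p
    by (rule has_derivative_transform_within_open[OF _ assms(1) that, of f])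
      (use Suc.prems assms(1) that in \<open>auto intro: differentiable_on_has_derivative\<close>)
  then have "\<forall>p\<in>S. frechet_derivative f (at p) v = frechet_derivative g (at p) v" for v
    using frechet_derivative_at by metis
  then have "Ck_on k (\<lambda>p. frechet_derivative g (at p) v) S" for v
    using Suc.IH[of "\<lambda>p. frechet_derivative f (at p) v"] Suc.prems by simp
  moreover have "g differentiable_on S"
    using der assms(1) by (auto simp: differentiable_on_eq_differentiable_at differentiable_def)
  ultimately show ?case by simp
qed

text \<open>Every closure property below is an induction on the order of differentiability: a formula for the
  derivative in terms of functions that are already known to be \<open>C\<^sup>k\<close> gives \<open>C\<^sup>k\<^sup>+\<^sup>1\<close>.\<close>

lemma Ck_on_derivI:
  assumes S: "open S"
    and der: "\<And>p. p \<in> S \<Longrightarrow> (f has_derivative f' p) (at p)"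
    and Ck: "\<And>v. Ck_on k (\<lambda>p. f' p v) S"
  shows "Ck_on (Suc k) f S"
proof -
  have "\<forall>p\<in>S. f' p v = frechet_derivative f (at p) v" for v
    using frechet_derivative_at[OF der] by simp
  then have "Ck_on k (\<lambda>p. frechet_derivative f (at p) v) S" for v
    by (rule Ck_on_cong[OF S _ Ck])
  moreover have "f differentiable_on S"
    using der S by (auto simp: differentiable_on_eq_differentiable_at differentiable_def)
  ultimately show ?thesis by simp
qed

lemma Ck_on_Suc_imp:
  assumes "open S" "Ck_on (Suc k) f S"
  shows "Ck_on k f S"
  using assms(2)
proof (induction k arbitrary: f)
  case 0
  then show ?case by (simp add: differentiable_imp_continuous_on)
next
  case (Suc k)
  then show ?case by (metis Ck_on.simps(2))
qed

lemma Ck_on_add: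
  assumes S: "open S" and "Ck_on k f S" "Ck_on k g S"
  shows "Ck_on k (\<lambda>p. f p + g p) S"
  using assms(2,3)
proof (induction k arbitrary: f g)
  case 0
  then show ?case by (simp add: continuous_on_add)
next
  case (Suc k)
  then show ?case
    by (intro Ck_on_derivI[OF S, where f' = "\<lambda>p v. frechet_derivative f (at p) v + frechet_derivative g (at p) v"])
      (auto intro!: has_derivative_add differentiable_on_has_derivative S)
qed

lemma Ck_on_const: "Ck_on k (\<lambda>p. c) S"
  by (induction k arbitrary: c) auto

lemma Ck_on_bounded_linear:
  assumes L: "bounded_linear L" and S: "open S" and "Ck_on k f S"
  shows "Ck_on k (\<lambda>p. L (f p)) S"
  using assms(3)
proof (induction k arbitrary: f)
  case 0
  then show ?case by (simp add: bounded_linear.continuous_on[OF L])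
next
  case (Suc k)
  then show ?case
    by (intro Ck_on_derivI[OF S, where f' = "\<lambda>p v. L (frechet_derivative f (at p) v)"])
      (auto intro!: bounded_linear.has_derivative[OF L] differentiable_on_has_derivative S)
qed

lemma Ck_on_bounded_bilinear:
  assumes B: "bounded_bilinear B" and S: "open S" and "Ck_on k f S" "Ck_on k g S"
  shows "Ck_on k (\<lambda>p. B (f p) (g p)) S"
  using assms(3,4)
proof (induction k arbitrary: f g)
  case 0
  then show ?case by (simp add: bounded_bilinear.continuous_on[OF B])
next
  case (Suc k)
  have fg: "Ck_on k f S" "Ck_on k g S"
    using Suc.prems Ck_on_Suc_imp[OF S] by blast+
  show ?case
    using Suc.prems fg
    by (intro Ck_on_derivI[OF S, where f' = "\<lambda>p v. B (f p) (frechet_derivative g (at p) v) +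
        B (frechet_derivative f (at p) v) (g p)"] Ck_on_add[OF S] Suc.IH)
      (auto intro!: bounded_bilinear.FDERIV[OF B] differentiable_on_has_derivative S)
qed

lemma smooth_on_cong: "open S \<Longrightarrow> \<forall>p\<in>S. f p = g p \<Longrightarrow> smooth_on f S \<Longrightarrow> smooth_on g S"
  unfolding smooth_on_def using Ck_on_cong by blast

lemma smooth_on_add:
  "open S \<Longrightarrow> smooth_on f S \<Longrightarrow> smooth_on g S \<Longrightarrow> smooth_on (\<lambda>p. f p + g p) S"
  by (simp add: smooth_on_def Ck_on_add)

lemma smooth_on_const: "smooth_on (\<lambda>p. c) S"
  by (simp add: smooth_on_def Ck_on_const)

lemma smooth_on_bounded_linear:
  "bounded_linear L \<Longrightarrow> open S \<Longrightarrow> smooth_on f S \<Longrightarrow> smooth_on (\<lambda>p. L (f p)) S"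
  by (simp add: smooth_on_def Ck_on_bounded_linear)

lemma smooth_on_bounded_bilinear:
  "bounded_bilinear B \<Longrightarrow> open S \<Longrightarrow> smooth_on f S \<Longrightarrow> smooth_on g S \<Longrightarrow>
    smooth_on (\<lambda>p. B (f p) (g p)) S"
  by (simp add: smooth_on_def Ck_on_bounded_bilinear)

lemma smooth_on_ident: "smooth_on (\<lambda>p. p) S"
  unfolding smooth_on_def
proof
  fix k show "Ck_on k (\<lambda>p. p) S"
    by (cases k) (auto simp: Ck_on_const)
qed

lemma smooth_on_sum:
  assumes "open S" "finite I" "\<And>i. i \<in> I \<Longrightarrow> smooth_on (f i) S"
  shows "smooth_on (\<lambda>p. \<Sum>i\<in>I. f i p) S"
  using assms(2,3)
  by (induction I rule: finite_induct) (auto simp: smooth_on_const intro: smooth_on_add assms(1))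

lemma smooth_on_has_derivative:
  assumes "smooth_on f S" "open S" "p \<in> S"
  shows "(f has_derivative frechet_derivative f (at p)) (at p)"
proof -
  have "Ck_on (Suc 0) f S" using assms by (simp only: smooth_on_def)
  then show ?thesis using assms by (auto intro: differentiable_on_has_derivative)
qed

lemma smooth_on_frechet_derivative:
  assumes "smooth_on f S"
  shows "smooth_on (\<lambda>p. frechet_derivative f (at p) v) S"
  unfolding smooth_on_def
proof
  fix k
  have "Ck_on (Suc k) f S" using assms by (simp only: smooth_on_def)
  then show "Ck_on k (\<lambda>p. frechet_derivative f (at p) v) S" by simp
qed

text \<open>Expanding \<open>\<xi>\<close> in the basis reduces the derivative along a field, which is evaluated at a varying
  vector, to derivatives along fixed vectors, which are smooth by definition.\<close>

lemma smooth_on_dir_deriv: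
  assumes S: "open S" and \<xi>: "smooth_on \<xi> S" and f: "smooth_on f S"
  shows "smooth_on (dir_deriv \<xi> f) S"
proof (rule smooth_on_cong[OF S])
  show "smooth_on (\<lambda>p. \<Sum>b\<in>Basis. (\<xi> p \<bullet> b) *\<^sub>R frechet_derivative f (at p) b) S"
    by (intro smooth_on_sum[OF S] smooth_on_bounded_bilinear[OF bounded_bilinear_scaleR S]
        smooth_on_bounded_linear[OF bounded_linear_inner_left S] smooth_on_frechet_derivative f \<xi>)
      auto
  show "\<forall>p\<in>S. (\<Sum>b\<in>Basis. (\<xi> p \<bullet> b) *\<^sub>R frechet_derivative f (at p) b) = dir_deriv \<xi> f p"
  proof
    fix p assume "p \<in> S"
    then interpret D: bounded_linear "frechet_derivative f (at p)"
      using smooth_on_has_derivative[OF f S] has_derivative_bounded_linear by blast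
    have "dir_deriv \<xi> f p = frechet_derivative f (at p) (\<Sum>b\<in>Basis. (\<xi> p \<bullet> b) *\<^sub>R b)"
      by (simp add: dir_deriv_def euclidean_representation)
    then show "(\<Sum>b\<in>Basis. (\<xi> p \<bullet> b) *\<^sub>R frechet_derivative f (at p) b) = dir_deriv \<xi> f p"
      by (simp add: D.sum D.scaleR)
  qed
qed

section \<open>Levi-Civita connections in a chart\<close>

text \<open>The data that describe a Levi-Civita connection in a single chart: a nondegenerate metric and
  candidate Christoffel symbols. The last assumption packs two facts into one: the product rule for
  \<open>g (\<eta>, \<zeta>)\<close> and the compatibility of \<open>\<Gamma>\<close> with \<open>g\<close>. In this form it never mentions the partial
  derivatives of \<open>g\<close>.\<close>

locale levi_civita_chart =
  fixes S :: "'a::euclidean_space set"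
    and g :: "'a \<Rightarrow> 'a \<Rightarrow> 'a \<Rightarrow> real"
    and \<Gamma> :: "'a \<Rightarrow> 'a \<Rightarrow> 'a \<Rightarrow> 'a"
  assumes open_S: "open S"
    and g_bilinear: "p \<in> S \<Longrightarrow> bilinear (g p)"
    and g_sym: "p \<in> S \<Longrightarrow> g p v w = g p w v"
    and g_nondeg: "p \<in> S \<Longrightarrow> (\<And>w. g p v w = 0) \<Longrightarrow> v = 0"
    and \<Gamma>_bilinear: "p \<in> S \<Longrightarrow> bilinear (\<Gamma> p)"
    and \<Gamma>_sym: "p \<in> S \<Longrightarrow> \<Gamma> p v w = \<Gamma> p w v"
    and \<Gamma>_smooth: "smooth_on \<xi> S \<Longrightarrow> smooth_on \<eta> S \<Longrightarrow> smooth_on (\<lambda>p. \<Gamma> p (\<xi> p) (\<eta> p)) S"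
    and g_has_derivative: "p \<in> S \<Longrightarrow> (\<eta> has_derivative \<eta>') (at p) \<Longrightarrow> (\<zeta> has_derivative \<zeta>') (at p) \<Longrightarrow>
      ((\<lambda>q. g q (\<eta> q) (\<zeta> q)) has_derivative
        (\<lambda>v. g p (\<eta>' v + \<Gamma> p v (\<eta> p)) (\<zeta> p) + g p (\<eta> p) (\<zeta>' v + \<Gamma> p v (\<zeta> p)))) (at p)"
begin

definition chart_nabla :: "'a connection" where
  "chart_nabla \<xi> \<eta> = (\<lambda>p. dir_deriv \<xi> \<eta> p + \<Gamma> p (\<xi> p) (\<eta> p))"

lemma affine_connection_chart_nabla: "affine_connection_on S chart_nabla"
  unfolding affine_connection_on_def
proof (intro conjI allI impI ballI)
  fix \<xi> \<eta> :: "'a \<Rightarrow> 'a" assume "smooth_on \<xi> S" "smooth_on \<eta> S"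
  then show "smooth_on (chart_nabla \<xi> \<eta>) S"
    unfolding chart_nabla_def by (intro smooth_on_add smooth_on_dir_deriv \<Gamma>_smooth open_S)
next
  fix \<xi> \<xi>' \<eta> :: "'a \<Rightarrow> 'a" and p
  assume *: "smooth_on \<eta> S" "p \<in> S"
  show "chart_nabla (\<lambda>q. \<xi> q + \<xi>' q) \<eta> p = chart_nabla \<xi> \<eta> p + chart_nabla \<xi>' \<eta> p"
    using bilinear_ladd[OF \<Gamma>_bilinear[OF *(2)]]
      linear_add[OF has_derivative_linear[OF smooth_on_has_derivative[OF *(1) open_S *(2)]]]
    by (simp add: chart_nabla_def dir_deriv_def)
next
  fix f :: "'a \<Rightarrow> real" and \<xi> \<eta> :: "'a \<Rightarrow> 'a" and p
  assume *: "smooth_on \<eta> S" "p \<in> S"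
  show "chart_nabla (\<lambda>q. f q *\<^sub>R \<xi> q) \<eta> p = f p *\<^sub>R chart_nabla \<xi> \<eta> p"
    using bilinear_lmul[OF \<Gamma>_bilinear[OF *(2)]]
      linear_scale[OF has_derivative_linear[OF smooth_on_has_derivative[OF *(1) open_S *(2)]]]
    by (simp add: chart_nabla_def dir_deriv_def scaleR_add_right)
next
  fix \<xi> \<eta> \<eta>' :: "'a \<Rightarrow> 'a" and p
  assume *: "smooth_on \<eta> S" "smooth_on \<eta>' S" "p \<in> S"
  have "frechet_derivative (\<lambda>q. \<eta> q + \<eta>' q) (at p) =
      (\<lambda>v. frechet_derivative \<eta> (at p) v + frechet_derivative \<eta>' (at p) v)"
    using * open_S by (intro frechet_derivative_at[symmetric] has_derivative_add smooth_on_has_derivative)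
  then show "chart_nabla \<xi> (\<lambda>q. \<eta> q + \<eta>' q) p = chart_nabla \<xi> \<eta> p + chart_nabla \<xi> \<eta>' p"
    using bilinear_radd[OF \<Gamma>_bilinear[OF *(3)]] by (simp add: chart_nabla_def dir_deriv_def)
next
  fix f :: "'a \<Rightarrow> real" and \<xi> \<eta> :: "'a \<Rightarrow> 'a" and p
  assume *: "smooth_on f S" "smooth_on \<eta> S" "p \<in> S"
  have "frechet_derivative (\<lambda>q. f q *\<^sub>R \<eta> q) (at p) =
      (\<lambda>v. f p *\<^sub>R frechet_derivative \<eta> (at p) v + frechet_derivative f (at p) v *\<^sub>R \<eta> p)"
    using * open_S by (intro frechet_derivative_at[symmetric] has_derivative_scaleR smooth_on_has_derivative)
  then show "chart_nabla \<xi> (\<lambda>q. f q *\<^sub>R \<eta> q) p =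
      dir_deriv \<xi> f p *\<^sub>R \<eta> p + f p *\<^sub>R chart_nabla \<xi> \<eta> p"
    using bilinear_rmul[OF \<Gamma>_bilinear[OF *(3)]]
    by (simp add: chart_nabla_def dir_deriv_def scaleR_add_right)
qed

lemma levi_civita_chart_nabla: "is_levi_civita_on S g chart_nabla"
  unfolding is_levi_civita_on_def
proof (intro conjI affine_connection_chart_nabla)
  show "torsion_free_on S chart_nabla"
    by (simp add: torsion_free_on_def chart_nabla_def lie_bracket_def \<Gamma>_sym)
  show "metric_compatible_on S g chart_nabla"
    unfolding metric_compatible_on_def
  proof (intro allI impI ballI)
    fix \<xi> \<eta> \<zeta> :: "'a \<Rightarrow> 'a" and p assume *: "smooth_on \<eta> S" "smooth_on \<zeta> S" "p \<in> S"
    show "dir_deriv \<xi> (\<lambda>q. g q (\<eta> q) (\<zeta> q)) p =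
        g p (chart_nabla \<xi> \<eta> p) (\<zeta> p) + g p (\<eta> p) (chart_nabla \<xi> \<zeta> p)"
      using frechet_derivative_at[OF g_has_derivative[OF *(3) smooth_on_has_derivative
          [OF *(1) open_S *(3)] smooth_on_has_derivative[OF *(2) open_S *(3)]], symmetric]
      by (simp add: dir_deriv_def chart_nabla_def)
  qed
qed

text \<open>Uniqueness without the Koszul formula: the difference of two Levi-Civita connections, paired with
  a third field by \<open>g\<close>, is symmetric in its first two arguments because both are torsion-free, and
  skew in its last two because both are metric. A trilinear form with these symmetries vanishes, and
  \<open>g\<close> is nondegenerate. Smooth fields, and not only constant ones, are needed here because the
  curvature differentiates the field \<open>\<nabla>\<^sub>w z\<close>.\<close>

lemma levi_civita_eq_chart_nabla:
  assumes \<xi>: "smooth_on \<xi> S" and \<eta>: "smooth_on \<eta> S" and p: "p \<in> S"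
  shows "levi_civita S g \<xi> \<eta> p = chart_nabla \<xi> \<eta> p"
proof -
  define N where "N = levi_civita S g"
  have N: "is_levi_civita_on S g N"
    unfolding N_def levi_civita_def by (rule someI[of "is_levi_civita_on S g", OF levi_civita_chart_nabla])
  define T where "T \<xi> \<eta> = N \<xi> \<eta> p - chart_nabla \<xi> \<eta> p" for \<xi> \<eta>
  define B where "B \<xi> \<eta> \<zeta> = g p (T \<xi> \<eta>) (\<zeta> p)" for \<xi> \<eta> and \<zeta> :: "'a \<Rightarrow> 'a"
  have "T \<xi> \<eta> = T \<eta> \<xi>" if "smooth_on \<xi> S" "smooth_on \<eta> S" for \<xi> \<eta>
  proof -
    have "N \<xi> \<eta> p - N \<eta> \<xi> p = chart_nabla \<xi> \<eta> p - chart_nabla \<eta> \<xi> p"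
      using N levi_civita_chart_nabla that p by (simp add: is_levi_civita_on_def torsion_free_on_def)
    then show ?thesis by (simp add: T_def algebra_simps)
  qed
  then have sym: "B \<xi> \<eta> \<zeta> = B \<eta> \<xi> \<zeta>" if "smooth_on \<xi> S" "smooth_on \<eta> S" for \<xi> \<eta> \<zeta>
    using that by (simp add: B_def)
  have skew: "B \<xi> \<eta> \<zeta> = - B \<xi> \<zeta> \<eta>" if "smooth_on \<xi> S" "smooth_on \<eta> S" "smooth_on \<zeta> S" for \<xi> \<eta> \<zeta>
  proof -
    have "g p (N \<xi> \<eta> p) (\<zeta> p) + g p (\<eta> p) (N \<xi> \<zeta> p) =
        g p (chart_nabla \<xi> \<eta> p) (\<zeta> p) + g p (\<eta> p) (chart_nabla \<xi> \<zeta> p)"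
      using N levi_civita_chart_nabla that p
      by (simp add: is_levi_civita_on_def metric_compatible_on_def)
    then show ?thesis
      by (simp add: B_def T_def bilinear_lsub[OF g_bilinear[OF p]] g_sym[OF p, of "\<eta> p"])
  qed
  have "B \<xi> \<eta> \<zeta> = 0" if \<zeta>: "smooth_on \<zeta> S" for \<zeta>
  proof -
    have "B \<xi> \<eta> \<zeta> = - B \<xi> \<zeta> \<eta>" using skew \<xi> \<eta> \<zeta> by blast
    also have "\<dots> = - B \<zeta> \<xi> \<eta>" using sym \<xi> \<eta> \<zeta> by simp
    also have "\<dots> = B \<zeta> \<eta> \<xi>" using skew[OF \<zeta> \<xi> \<eta>] by simp
    also have "\<dots> = B \<eta> \<zeta> \<xi>" using sym \<eta> \<zeta> by blast
    also have "\<dots> = - B \<eta> \<xi> \<zeta>" using skew \<xi> \<eta> \<zeta> by blast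
    also have "\<dots> = - B \<xi> \<eta> \<zeta>" using sym \<xi> \<eta> by simp
    finally show ?thesis by simp
  qed
  from this[OF smooth_on_const] have "g p (T \<xi> \<eta>) w = 0" for w
    by (simp add: B_def)
  then have "T \<xi> \<eta> = 0" by (rule g_nondeg[OF p])
  then show ?thesis by (simp add: T_def N_def)
qed

text \<open>For constant fields the Lie bracket vanishes and \<open>\<nabla>\<^sub>w z = \<Gamma> w z\<close>, so only the derivative of the
  Christoffel symbols and their products remain.\<close>

lemma riemann_tensor_eq:
  assumes p: "p \<in> S"
    and dv: "((\<lambda>q. \<Gamma> q w z) has_derivative d\<Gamma>wz) (at p)"
    and dw: "((\<lambda>q. \<Gamma> q v z) has_derivative d\<Gamma>vz) (at p)"
  shows "riemann_tensor S g p v w z =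
    d\<Gamma>wz v - d\<Gamma>vz w + \<Gamma> p v (\<Gamma> p w z) - \<Gamma> p w (\<Gamma> p v z)"
proof -
  have nabla_const: "levi_civita S g (\<lambda>_. a) (\<lambda>_. z) q = \<Gamma> q a z" if "q \<in> S" for a q
    using levi_civita_eq_chart_nabla[OF smooth_on_const smooth_on_const that]
    by (simp add: chart_nabla_def dir_deriv_def)
  have second: "levi_civita S g (\<lambda>_. b) (levi_civita S g (\<lambda>_. a) (\<lambda>_. z)) p = d b + \<Gamma> p b (\<Gamma> p a z)"
    if d: "((\<lambda>q. \<Gamma> q a z) has_derivative d) (at p)" for a b d
  proof -
    let ?\<eta> = "levi_civita S g (\<lambda>_. a) (\<lambda>_. z)"
    have "smooth_on ?\<eta> S"
      by (rule smooth_on_cong[OF open_S _ \<Gamma>_smooth[OF smooth_on_const smooth_on_const, of a z]])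
        (simp add: nabla_const)
    then have "levi_civita S g (\<lambda>_. b) ?\<eta> p = dir_deriv (\<lambda>_. b) ?\<eta> p + \<Gamma> p b (?\<eta> p)"
      using levi_civita_eq_chart_nabla[OF smooth_on_const _ p] by (simp add: chart_nabla_def)
    moreover have "(?\<eta> has_derivative d) (at p)"
      by (rule has_derivative_transform_within_open[OF d open_S p]) (simp add: nabla_const)
    ultimately show ?thesis
      using frechet_derivative_at by (fastforce simp: dir_deriv_def nabla_const p)
  qed
  have "lie_bracket (\<lambda>_. v) (\<lambda>_. w) = (\<lambda>_. 0)"
    by (simp add: lie_bracket_def dir_deriv_def fun_eq_iff)
  then show ?thesis
    by (simp add: riemann_tensor_def curvature_def second[OF dv] second[OF dw] nabla_const[OF p]
        bilinear_lzero[OF \<Gamma>_bilinear[OF p]])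
qed

end

section \<open>Matrix algebra\<close>

lemma trace_scaleR: "trace (c *\<^sub>R A) = c * trace (A :: real^'n^'n)"
  by (simp add: trace_def sum_distrib_left)

lemma trace_minus: "trace (- A) = - trace (A :: real^'n^'n)"
  by (simp add: trace_def sum_negf)

lemma trace_transpose: "trace (transpose A) = trace A"
  by (simp add: trace_def transpose_def)

lemma inner_matrix_eq_trace: "A \<bullet> B = trace (A ** transpose B)" for A B :: "real^'n^'m"
  by (simp add: trace_def inner_vec_def matrix_matrix_mult_def transpose_def)

lemma matrix_scaleR_left: "(c *\<^sub>R A) ** B = c *\<^sub>R (A ** B)" for A :: "real^'n^'m"
  by (rule scalar_matrix_assoc[symmetric])

lemma matrix_scaleR_right: "A ** (c *\<^sub>R B) = c *\<^sub>R (A ** B)" for A :: "real^'n^'m"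
  by (simp add: matrix_scalar_ac scalar_matrix_assoc)

lemma matrix_add_rdistrib: "(A + B) ** C = A ** C + B ** C" for A :: "real^'n^'m"
  by (simp add: vec_eq_iff matrix_matrix_mult_def sum.distrib algebra_simps)

lemma matrix_minus_left: "(- A) ** B = - (A ** B)" for A :: "real^'n^'m"
  using matrix_scaleR_left[of "-1" A B] by simp

lemma matrix_minus_right: "A ** (- B) = - (A ** B)" for A :: "real^'n^'m"
  using matrix_scaleR_right[of A "-1" B] by simp

lemma matrix_diff_left: "(A - B) ** C = A ** C - B ** C" for A :: "real^'n^'m"
  using matrix_add_rdistrib[of A "-B" C] by (simp add: matrix_minus_left)

lemma matrix_diff_right: "A ** (B - C) = A ** B - A ** C" for A :: "real^'n^'m"
  using matrix_add_ldistrib[of A B "-C"] by (simp add: matrix_minus_right)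

lemma matrix_minus_vector: "(- A) *v x = - (A *v x)" for A :: "real^'n^'m"
  using matrix_vector_mult_diff_rdistrib[of 0 A x] by simp

lemma bounded_bilinear_matrix_mult:
  "bounded_bilinear ((**) :: real^'n^'m \<Rightarrow> real^'p^'n \<Rightarrow> real^'p^'m)"
  by (auto simp: bilinear_conv_bounded_bilinear[symmetric] bilinear_def
      matrix_add_ldistrib matrix_add_rdistrib matrix_scaleR_left matrix_scaleR_right intro!: linearI)

lemma bounded_bilinear_matrix_vector_mult:
  "bounded_bilinear ((*v) :: real^'n^'m \<Rightarrow> real^'n \<Rightarrow> real^'m)"
  by (auto simp: bilinear_conv_bounded_bilinear[symmetric] bilinear_def
      algebra_simps scaleR_matrix_vector_assoc intro!: linearI)

lemma bounded_linear_trace: "bounded_linear (trace :: real^'n^'n \<Rightarrow> real)"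
  by (auto simp: linear_conv_bounded_linear[symmetric] trace_add trace_scaleR intro!: linearI)

lemma matrix_inv_left: "invertible A \<Longrightarrow> matrix_inv A ** A = mat 1"
  and matrix_inv_right: "invertible A \<Longrightarrow> A ** matrix_inv A = mat 1" for A :: "real^'n^'m"
  unfolding invertible_def matrix_inv_def by (rule someI2_ex; simp)+

definition outer :: "real^'m \<Rightarrow> real^'n \<Rightarrow> real^'n^'m" where
  "outer x y = (\<chi> i j. x $ i * y $ j)"

lemma bounded_bilinear_outer: "bounded_bilinear (outer :: real^'m \<Rightarrow> real^'n \<Rightarrow> real^'n^'m)"
  by (auto simp: bilinear_conv_bounded_bilinear[symmetric] bilinear_def outer_def vec_eq_iff
      algebra_simps intro!: linearI)

lemma matrix_mult_outer: "A ** outer x y = outer (A *v x) y"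
  by (simp add: vec_eq_iff outer_def matrix_matrix_mult_def matrix_vector_mult_def
      sum_distrib_right mult.assoc)

lemma outer_mult_matrix: "outer x y ** A = outer x (transpose A *v y)"
  by (simp add: vec_eq_iff outer_def matrix_matrix_mult_def matrix_vector_mult_def transpose_def
      sum_distrib_left mult_ac)

lemma trace_outer: "trace (outer x y) = x \<bullet> y"
  by (simp add: trace_def outer_def inner_vec_def)

lemma transpose_outer: "transpose (outer x y) = outer y x"
  by (simp add: vec_eq_iff transpose_def outer_def mult.commute)

lemma transpose_add: "transpose (A + B) = transpose A + transpose B" for A :: "real^'n^'m"
  by (simp add: vec_eq_iff transpose_def)

lemma transpose_minus: "transpose (- A) = - transpose A" for A :: "real^'n^'m"
  by (simp add: vec_eq_iff transpose_def)

lemma transpose_diff: "transpose (A - B) = transpose A - transpose B" for A :: "real^'n^'m"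
  by (simp add: vec_eq_iff transpose_def)

lemma outer_mult_vector: "outer x y *v z = (y \<bullet> z) *\<^sub>R x"
  by (simp add: vec_eq_iff outer_def matrix_vector_mult_def inner_vec_def sum_distrib_left mult_ac)

lemma inner_symmetric_matrix_vector:
  "transpose A = A \<Longrightarrow> x \<bullet> (A *v y) = (A *v x) \<bullet> y" for A :: "real^'n^'n"
  by (metis dot_lmul_matrix vector_transpose_matrix)

section \<open>Symmetric matrices and traces over them\<close>

lemma bounded_linear_of_sym: "bounded_linear of_sym"
  by (auto simp: linear_conv_bounded_linear[symmetric] intro!: linearI)

definition symm :: "real^'n^'n \<Rightarrow> 'n sym_matrix" where
  "symm A = to_sym ((1 / 2) *\<^sub>R (A + transpose A))"

lemma of_sym_symm: "of_sym (symm A) = (1 / 2) *\<^sub>R (A + transpose A)"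
  unfolding symm_def
  by (rule of_sym_to_sym) (simp add: transpose_scalar transpose_add add.commute)

lemma bounded_linear_symm: "bounded_linear (symm :: real^'n^'n \<Rightarrow> 'n sym_matrix)"
  by (auto simp: linear_conv_bounded_linear[symmetric] sym_matrix_eq_iff of_sym_symm transpose_add
      transpose_scalar algebra_simps intro!: linearI)

lemma inner_symm: "symm A \<bullet> B = A \<bullet> of_sym B"
proof -
  have "transpose A \<bullet> of_sym B = A \<bullet> of_sym B"
    by (simp add: inner_matrix_eq_trace transpose_of_sym)
      (metis matrix_transpose_mul trace_mul_sym trace_transpose transpose_of_sym transpose_transpose)
  then show ?thesis
    by (simp add: inner_sym_matrix_def of_sym_symm inner_add_left)
qed

text \<open>The left-hand side is the \<open>(k, l)\<close> entry of the expansion, in the orthonormal basis, of the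
  symmetric part of the matrix unit \<open>E\<^sub>i\<^sub>j\<close>. Only orthonormality enters; the basis vectors are
  never inspected.\<close>

lemma sum_Basis_sym_matrix_entries:
  fixes i j k l :: "'n::finite"
  shows "(\<Sum>b\<in>Basis. of_sym b $ i $ j * of_sym b $ k $ l) =
    ((if i = k \<and> j = l then 1 else 0) + (if i = l \<and> j = k then 1 else 0)) / 2"
proof -
  define E :: "real^'n^'n" where "E = outer (axis i 1) (axis j 1)"
  have E_entry: "E $ r $ s = (if i = r \<and> j = s then 1 else 0)" for r s
    by (auto simp: E_def outer_def axis_def)
  have E: "E \<bullet> B = B $ i $ j" for B
    by (simp add: E_def outer_def inner_vec_def axis_def if_distrib[of "\<lambda>x. x * _"] sum.If_cases
        cong: if_cong)
  have "(\<Sum>b\<in>Basis. of_sym b $ i $ j * of_sym b $ k $ l) =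
      (\<Sum>b\<in>Basis. of_sym ((symm E \<bullet> b) *\<^sub>R b)) $ k $ l"
    by (simp add: inner_symm E sum_component)
  also have "\<dots> = of_sym (\<Sum>b\<in>Basis. (symm E \<bullet> b) *\<^sub>R b) $ k $ l"
    by (simp only: linear_sum[OF bounded_linear.linear[OF bounded_linear_of_sym]])
  also have "\<dots> = ((1 / 2) *\<^sub>R (E + transpose E)) $ k $ l"
    by (simp only: euclidean_representation of_sym_symm)
  also have "\<dots> = ((if i = k \<and> j = l then 1 else 0) + (if i = l \<and> j = k then 1 else 0)) / 2"
    by (simp add: E_entry transpose_def)
  finally show ?thesis .
qed

text \<open>The trace of \<open>Z \<mapsto> A Z B\<close>, symmetrized, on the space of symmetric matrices. Apart from
  maps of rank one, the traces over the symmetric part of the tangent space are instances of it.\<close>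

lemma sum_Basis_sym_matrix_sandwich:
  fixes A B :: "real^'n^'n"
  shows "(\<Sum>b\<in>Basis. (A ** of_sym b ** B) \<bullet> of_sym b) = (trace A * trace B + A \<bullet> B) / 2"
proof -
  have "(\<Sum>b\<in>Basis. (A ** of_sym b ** B) \<bullet> of_sym b) =
      (\<Sum>b\<in>Basis. \<Sum>i\<in>UNIV. \<Sum>l\<in>UNIV. \<Sum>k\<in>UNIV. \<Sum>j\<in>UNIV.
        A $ i $ j * B $ k $ l * (of_sym b $ j $ k * of_sym b $ i $ l))"
    by (simp add: inner_vec_def matrix_matrix_mult_def sum_distrib_left sum_distrib_right mult_ac)
  also have "\<dots> = (\<Sum>i\<in>UNIV. \<Sum>l\<in>UNIV. \<Sum>k\<in>UNIV. \<Sum>j\<in>UNIV.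
        A $ i $ j * B $ k $ l * (\<Sum>b\<in>Basis. of_sym b $ j $ k * of_sym b $ i $ l))"
    unfolding sum_distrib_left
    by (subst sum.swap[of _ _ Basis], intro sum.cong refl)+
  also have "\<dots> = (\<Sum>i\<in>UNIV. \<Sum>l\<in>UNIV. (A $ i $ i * B $ l $ l + A $ i $ l * B $ i $ l) / 2)"
  proof (intro sum.cong refl)
    fix i l :: 'n
    have "(\<Sum>k\<in>UNIV. \<Sum>j\<in>UNIV.
        A $ i $ j * B $ k $ l * (\<Sum>b\<in>Basis. of_sym b $ j $ k * of_sym b $ i $ l)) =
      (\<Sum>k\<in>UNIV. \<Sum>j\<in>UNIV. (if j = i then if k = l then A $ i $ j * B $ k $ l / 2 else 0 else 0)) +
      (\<Sum>k\<in>UNIV. \<Sum>j\<in>UNIV. (if j = l then if k = i then A $ i $ j * B $ k $ l / 2 else 0 else 0))"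
      unfolding sum.distrib[symmetric] sum_Basis_sym_matrix_entries
      by (intro sum.cong refl) auto
    also have "\<dots> = (A $ i $ i * B $ l $ l + A $ i $ l * B $ i $ l) / 2"
      by (simp add: add_divide_distrib)
    finally show "(\<Sum>k\<in>UNIV. \<Sum>j\<in>UNIV.
        A $ i $ j * B $ k $ l * (\<Sum>b\<in>Basis. of_sym b $ j $ k * of_sym b $ i $ l)) =
      (A $ i $ i * B $ l $ l + A $ i $ l * B $ i $ l) / 2" .
  qed
  also have "\<dots> = (trace A * trace B + A \<bullet> B) / 2"
    by (simp add: trace_def inner_vec_def sum.distrib sum_divide_distrib[symmetric] sum_product)
  finally show ?thesis .
qed

lemma sum_Basis_matrix_vector_inner:
  fixes A :: "real^'n^'n"
  shows "(\<Sum>e\<in>Basis. (A *v e) \<bullet> e) = trace A"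
proof -
  have "(\<Sum>e\<in>Basis. (A *v e) \<bullet> e) = (\<Sum>i\<in>UNIV. (A *v axis i 1) \<bullet> axis i 1)"
    by (simp add: Basis_vec_def UNION_singleton_eq_range sum.reindex inj_on_def axis_eq_axis)
  also have "\<dots> = trace A"
    by (simp add: trace_def inner_axis matrix_vector_mult_basis column_def)
  finally show ?thesis .
qed

lemma linear_trace_prod:
  fixes L :: "'a::euclidean_space \<times> 'b::euclidean_space \<Rightarrow> 'a \<times> 'b"
  shows "linear_trace L = (\<Sum>b\<in>Basis. fst (L (b, 0)) \<bullet> b) + (\<Sum>e\<in>Basis. snd (L (0, e)) \<bullet> e)"
proof -
  have "inj_on (\<lambda>b. (b :: 'a, 0 :: 'b)) Basis" "inj_on (Pair (0 :: 'a)) (Basis :: 'b set)"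
    "(\<lambda>b. (b :: 'a, 0 :: 'b)) ` Basis \<inter> Pair 0 ` Basis = {}"
    by (auto simp: inj_on_def)
  then show ?thesis
    by (simp add: linear_trace_def Basis_prod_def sum.union_disjoint sum.reindex inner_Pair_0)
qed

section \<open>Differentiability of the matrix inverse\<close>

lemma continuous_det: "continuous_on UNIV (det :: real^'n^'n \<Rightarrow> real)"
  unfolding det_def by (intro continuous_intros)

text \<open>By Cramer's rule the entries of the inverse are quotients of determinants.\<close>

lemma isCont_matrix_inv:
  fixes A :: "real^'n^'n"
  assumes "invertible A"
  shows "isCont matrix_inv A"
proof -
  let ?U = "{A :: real^'n^'n. det A \<noteq> 0}"
  let ?C = "\<lambda>i j (A :: real^'n^'n). (\<chi> r s. if s = i then axis j 1 $ r else A $ r $ s) :: real^'n^'n"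
  have open_U: "open ?U"
    using open_Collect_neq[OF continuous_det continuous_on_const[of UNIV 0]] by simp
  have entry: "matrix_inv A $ i $ j = det (?C i j A) / det A" if "A \<in> ?U" for A i j
  proof -
    have "A ** matrix_inv A = mat 1"
      using that by (simp add: invertible_det_nz matrix_inv_right)
    then have "A *v (matrix_inv A *v axis j 1) = axis j 1"
      by (simp add: matrix_vector_mul_assoc)
    then have "matrix_inv A *v axis j 1 = (\<chi> i. det (?C i j A) / det A)"
      using that cramer by blast
    then show ?thesis
      by (metis (no_types, lifting) column_def matrix_vector_mult_basis vec_lambda_beta)
  qed
  have C: "continuous_on ?U (?C i j)" for i j
  proof (intro continuous_on_vec_lambda)
    fix r s show "continuous_on ?U (\<lambda>A. if s = i then axis j 1 $ r else A $ r $ s)"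
      by (cases "s = i") (auto intro!: continuous_intros)
  qed
  have "continuous_on ?U (\<lambda>A. det (?C i j A) / det A)" for i j
    by (intro continuous_on_divide continuous_on_compose2[OF continuous_det C]
        continuous_on_subset[OF continuous_det]) auto
  then have "continuous_on ?U (\<lambda>A. matrix_inv A $ i $ j)" for i j
    by (rule continuous_on_eq) (simp add: entry)
  then have "continuous_on ?U (\<lambda>A. \<chi> i j. matrix_inv A $ i $ j)"
    by (intro continuous_on_vec_lambda)
  then show ?thesis
    using open_U assms by (simp add: continuous_on_eq_continuous_at invertible_det_nz)
qed

text \<open>From \<open>B\<^sup>-\<^sup>1 (B - A) A\<^sup>-\<^sup>1 = A\<^sup>-\<^sup>1 - B\<^sup>-\<^sup>1\<close> the remainder of the linear approximation is
  \<open>(A\<^sup>-\<^sup>1 - B\<^sup>-\<^sup>1) (B - A) A\<^sup>-\<^sup>1\<close>, whose first factor tends to zero by continuity.\<close>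

lemma has_derivative_matrix_inv:
  fixes A :: "real^'n^'n"
  assumes A: "invertible A"
  shows "(matrix_inv has_derivative (\<lambda>H. - (matrix_inv A ** H ** matrix_inv A))) (at A)"
proof -
  let ?I = "matrix_inv :: real^'n^'n \<Rightarrow> real^'n^'n"
  have "\<exists>K>0. \<forall>X Y :: real^'n^'n. norm (X ** Y) \<le> norm X * norm Y * K"
    by (rule bounded_bilinear.pos_bounded[OF bounded_bilinear_matrix_mult])
  then obtain K where K: "norm (X ** Y) \<le> norm X * norm Y * K" and "K > 0" for X Y :: "real^'n^'n"
    by blast
  have open_U: "open {B :: real^'n^'n. invertible B}"
    using open_Collect_neq[OF continuous_det continuous_on_const[of UNIV 0]] by (simp add: invertible_det_nz)
  have remainder: "?I B - ?I A + ?I A ** (B - A) ** ?I A = (?I A - ?I B) ** (B - A) ** ?I A"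
    if B: "invertible B" for B
  proof -
    have "?I B ** B = mat 1" "A ** ?I A = mat 1"
      using A B by (simp_all add: matrix_inv_left matrix_inv_right)
    then have "?I B ** (B - A) ** ?I A = ?I A - ?I B"
      by (simp add: matrix_diff_left matrix_diff_right matrix_mul_assoc[symmetric, of "?I B" A])
    then show ?thesis
      by (simp add: matrix_diff_left)
  qed
  show ?thesis
    unfolding has_derivative_iff_norm
  proof
    show "bounded_linear (\<lambda>H. - (?I A ** H ** ?I A))"
      by (intro bounded_linear_minus bounded_linear_compose
          [OF bounded_bilinear.bounded_linear_left[OF bounded_bilinear_matrix_mult]
            bounded_bilinear.bounded_linear_right[OF bounded_bilinear_matrix_mult]])
    show "((\<lambda>B. norm (?I B - ?I A - - (?I A ** (B - A) ** ?I A)) / norm (B - A)) \<longlongrightarrow> 0) (at A)"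
    proof (rule Lim_null_comparison)
      have "\<forall>\<^sub>F B in at A. invertible B \<and> B \<noteq> A"
        using A eventually_at_in_open[OF open_U, of A] by (auto elim: eventually_mono)
      then show "\<forall>\<^sub>F B in at A. norm (norm (?I B - ?I A - - (?I A ** (B - A) ** ?I A)) / norm (B - A))
          \<le> norm (?I A - ?I B) * (K * norm (?I A) * K)"
      proof eventually_elim
        case (elim B)
        have "norm (?I B - ?I A - - (?I A ** (B - A) ** ?I A)) =
            norm ((?I A - ?I B) ** (B - A) ** ?I A)"
          using remainder[of B] elim by simp
        also have "\<dots> \<le> norm ((?I A - ?I B) ** (B - A)) * norm (?I A) * K"
          by (rule K)
        also have "\<dots> \<le> (norm (?I A - ?I B) * norm (B - A) * K) * norm (?I A) * K"
          using K \<open>K > 0\<close> by (intro mult_right_mono) auto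
        finally show ?case
          using elim by (simp add: field_simps)
      qed
      have "((\<lambda>B. norm (?I A - ?I B) * (K * norm (?I A) * K)) \<longlongrightarrow> norm (?I A - ?I A) * (K * norm (?I A) * K)) (at A)"
        using isCont_matrix_inv[OF A] by (intro tendsto_intros) (simp add: isCont_def)
      then show "((\<lambda>B. norm (?I A - ?I B) * (K * norm (?I A) * K)) \<longlongrightarrow> 0) (at A)"
        by simp
    qed
  qed
qed

text \<open>The derivative of the inverse is a polynomial in the inverse and the derivative of the matrix, so
  the order of differentiability bootstraps.\<close>

lemma smooth_on_matrix_inv:
  fixes A :: "'a::euclidean_space \<Rightarrow> real^'n^'n"
  assumes S: "open S" and A: "smooth_on A S" and inv: "\<And>p. p \<in> S \<Longrightarrow> invertible (A p)"
  shows "smooth_on (\<lambda>p. matrix_inv (A p)) S"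
proof -
  let ?I = "\<lambda>p. matrix_inv (A p)"
  have der: "(?I has_derivative (\<lambda>v. - (?I p ** frechet_derivative A (at p) v ** ?I p))) (at p)"
    if "p \<in> S" for p
    using has_derivative_compose[OF smooth_on_has_derivative[OF A S that] has_derivative_matrix_inv[OF inv[OF that]]] .
  have "Ck_on k ?I S" for k
  proof (induction k)
    case 0
    then show ?case
      using der by (auto simp: intro!: continuous_at_imp_continuous_on has_derivative_continuous)
  next
    case (Suc k)
    have "Ck_on k (\<lambda>p. frechet_derivative A (at p) v) S" for v
      using smooth_on_frechet_derivative[OF A] by (simp add: smooth_on_def)
    then show ?case
      by (intro Ck_on_derivI[OF S der] Ck_on_bounded_linear[OF bounded_linear_minus[OF bounded_linear_ident] S]
          Ck_on_bounded_bilinear[OF bounded_bilinear_matrix_mult S] Suc.IH)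
  qed
  then show ?thesis by (simp add: smooth_on_def)
qed

section \<open>Positive definite matrices\<close>

lemma pos_def_invertible:
  assumes "pos_def D"
  shows "invertible (of_sym D)"
  unfolding invertible_left_inverse matrix_left_invertible_ker
proof (intro allI impI)
  fix x assume "of_sym D *v x = 0"
  then have "\<not> x \<bullet> (of_sym D *v x) > 0" by simp
  then show "x = 0" using assms unfolding pos_def_def by blast
qed

lemma transpose_matrix_inv:
  fixes A :: "real^'n^'n"
  assumes "invertible A" "transpose A = A"
  shows "transpose (matrix_inv A) = matrix_inv A"
proof -
  have 1: "matrix_inv A ** A = mat 1" "A ** matrix_inv A = mat 1"
    using assms by (simp_all add: matrix_inv_left matrix_inv_right)
  then have "transpose (matrix_inv A) = transpose (matrix_inv A) ** transpose A ** matrix_inv A"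
    by (simp add: assms(2) matrix_mul_assoc[symmetric])
  also have "\<dots> = matrix_inv A"
    by (simp add: matrix_transpose_mul[symmetric] 1)
  finally show ?thesis .
qed

text \<open>By homogeneity, \<open>D\<close> fails to be positive definite iff the quadratic form is nonpositive at some
  vector of the unit sphere; the set of such \<open>D\<close> is the projection of a closed set along a compact
  factor.\<close>

lemma open_pos_def: "open {D. pos_def (D :: 'n::finite sym_matrix)}"
proof -
  define U where "U = {(x, D :: 'n sym_matrix). x \<in> sphere 0 1 \<and> x \<bullet> (of_sym D *v x) \<le> 0}"
  have cont: "continuous_on UNIV (\<lambda>q :: (real^'n) \<times> 'n sym_matrix. fst q \<bullet> (of_sym (snd q) *v fst q))"
    by (intro continuous_intros bounded_bilinear.continuous_on[OF bounded_bilinear_matrix_vector_mult]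
        bounded_linear.continuous_on[OF bounded_linear_of_sym])
  have "closed {q :: (real^'n) \<times> 'n sym_matrix. fst q \<bullet> (of_sym (snd q) *v fst q) \<le> 0}"
    using closed_Collect_le[OF cont continuous_on_const] by simp
  then have "closedin (top_of_set (sphere 0 1 \<times> UNIV))
      ((sphere 0 1 \<times> UNIV) \<inter> {q :: (real^'n) \<times> 'n sym_matrix. fst q \<bullet> (of_sym (snd q) *v fst q) \<le> 0})"
    by (rule closedin_closed_Int)
  then have "closedin (top_of_set (sphere 0 1 \<times> UNIV)) U"
    by (rule back_subst[of "closedin _"]) (auto simp: U_def)
  from closedin_compact_projection[OF compact_sphere this]
  have "closed {D. \<exists>x. x \<in> sphere 0 1 \<and> (x, D) \<in> U}"
    by simp
  also have "{D. \<exists>x. x \<in> sphere 0 1 \<and> (x, D) \<in> U} = - {D. pos_def D}"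
  proof (intro set_eqI iffI)
    fix D :: "'n sym_matrix" assume "D \<in> - {D. pos_def D}"
    then obtain x where x: "x \<noteq> 0" "x \<bullet> (of_sym D *v x) \<le> 0"
      by (auto simp: pos_def_def not_less)
    let ?y = "(1 / norm x) *\<^sub>R x"
    have "?y \<bullet> (of_sym D *v ?y) = (x \<bullet> (of_sym D *v x)) / (norm x * norm x)"
      by (simp add: matrix_vector_mult_scaleR divide_simps)
    also have "\<dots> \<le> 0"
      using x(2) by (simp add: divide_nonpos_nonneg)
    finally have "?y \<in> sphere 0 1 \<and> (?y, D) \<in> U"
      using x(1) unfolding U_def by simp
    then show "D \<in> {D. \<exists>x. x \<in> sphere 0 1 \<and> (x, D) \<in> U}"
      by blast
  next
    fix D :: "'n sym_matrix" assume "D \<in> {D. \<exists>x. x \<in> sphere 0 1 \<and> (x, D) \<in> U}"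
    then obtain x where "norm x = 1" "x \<bullet> (of_sym D *v x) \<le> 0"
      by (auto simp: U_def)
    moreover from this have "x \<noteq> 0" by auto
    ultimately show "D \<in> - {D. pos_def D}"
      by (auto simp: pos_def_def not_less intro!: exI[of _ x])
  qed
  finally show ?thesis by (simp only: open_closed)
qed

lemma open_Xi: "open Xi"
  unfolding Xi_def by (intro open_Times open_pos_def open_UNIV)

section \<open>The metric and its Christoffel symbols\<close>

lemmas matrix_linear_simps =
  matrix_add_ldistrib matrix_add_rdistrib matrix_diff_left matrix_diff_right matrix_minus_left
  matrix_minus_right matrix_scaleR_left matrix_scaleR_right matrix_mul_assoc
  trace_add trace_sub trace_minus trace_scaleR

abbreviation mpart :: "'n::finite sym_matrix \<times> (real^'n) \<Rightarrow> real^'n^'n" where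
  "mpart v \<equiv> of_sym (fst v)"

abbreviation minv :: "'n::finite sym_matrix \<times> (real^'n) \<Rightarrow> real^'n^'n" where
  "minv v \<equiv> inv_sym (fst v)"

lemma Xi_minv:
  assumes "p \<in> Xi"
  shows "minv p ** mpart p = mat 1" "mpart p ** minv p = mat 1" "transpose (minv p) = minv p"
    "minv p *v (mpart p *v x) = x" "mpart p *v (minv p *v x) = x"
proof -
  have inv: "invertible (mpart p)"
    using assms by (auto simp: Xi_def intro: pos_def_invertible)
  then show *: "minv p ** mpart p = mat 1" "mpart p ** minv p = mat 1" "transpose (minv p) = minv p"
    by (simp_all add: matrix_inv_left matrix_inv_right transpose_matrix_inv)
  show "minv p *v (mpart p *v x) = x" "mpart p *v (minv p *v x) = x"
    by (simp_all add: matrix_vector_mul_assoc *)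
qed

lemma Xi_metric_eq:
  "Xi_metric \<alpha> \<beta> p v w =
    1 / 2 * trace (minv p ** mpart v ** minv p ** mpart w) +
    \<alpha> * trace (minv p ** mpart v) * trace (minv p ** mpart w) +
    \<beta> * (snd v \<bullet> (mpart p *v snd w))"
  by (cases p; cases v; cases w) (simp add: Xi_metric_def)

lemma bilinear_Xi_metric: "bilinear (Xi_metric \<alpha> \<beta> p)"
  unfolding bilinear_def
  by (auto intro!: linearI
      simp: Xi_metric_eq matrix_linear_simps algebra_simps inner_add_left inner_add_right)

lemma Xi_metric_sym: "Xi_metric \<alpha> \<beta> p v w = Xi_metric \<alpha> \<beta> p w v"
proof -
  have "trace (minv p ** mpart v ** minv p ** mpart w) = trace (minv p ** mpart w ** minv p ** mpart v)"
    using trace_mul_sym[of "minv p ** mpart v" "minv p ** mpart w"] by (simp add: matrix_mul_assoc)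
  moreover have "snd v \<bullet> (mpart p *v snd w) = snd w \<bullet> (mpart p *v snd v)"
    by (metis inner_symmetric_matrix_vector inner_commute transpose_of_sym)
  ultimately show ?thesis by (simp add: Xi_metric_eq)
qed

text \<open>Testing \<open>(X, x)\<close> against \<open>(0, x)\<close> kills \<open>x\<close>. Testing against \<open>(D, 0)\<close> gives
  \<open>(1 + 2n\<alpha>) Tr (D\<^sup>-\<^sup>1 X) = 0\<close>, which is where the restriction on \<open>\<alpha>\<close> enters; after that the
  \<open>\<alpha>\<close> term is gone, and testing against \<open>D\<^sup>-\<^sup>1 X D\<^sup>-\<^sup>1\<close> gives half the squared norm of this matrix.\<close>

lemma Xi_metric_nondegenerate:
  fixes v :: "'n::finite sym_matrix \<times> (real^'n)"
  assumes p: "p \<in> Xi" and \<alpha>: "1 + 2 * real CARD('n) * \<alpha> \<noteq> 0" and \<beta>: "\<beta> \<noteq> 0"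
    and g: "\<And>w. Xi_metric \<alpha> \<beta> p v w = 0"
  shows "v = 0"
proof -
  let ?P = "minv p" and ?D = "mpart p" and ?X = "mpart v"
  note P = Xi_minv[OF p]
  have "snd v \<bullet> (?D *v snd v) = 0"
    using g[of "(0, snd v)"] \<beta> by (simp add: Xi_metric_eq trace_def)
  moreover have "pos_def (fst p)"
    using p by (auto simp: Xi_def)
  ultimately have x: "snd v = 0"
    unfolding pos_def_def by (metis less_irrefl)
  have "trace (?P ** ?X) * (1 + 2 * real CARD('n) * \<alpha>) = 2 * Xi_metric \<alpha> \<beta> p v (fst p, 0)"
    by (simp add: Xi_metric_eq P trace_I matrix_mul_assoc[symmetric, of _ ?P ?D] algebra_simps)
  then have tr: "trace (?P ** ?X) = 0"
    using g \<alpha> by simp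
  let ?Z = "?P ** ?X ** ?P"
  have "transpose ?Z = ?Z"
    by (simp add: matrix_transpose_mul P matrix_mul_assoc)
  then have Z: "of_sym (to_sym ?Z) = ?Z" and Zt: "transpose ?Z = ?Z"
    by (simp_all add: of_sym_to_sym)
  have "?Z \<bullet> ?Z = 2 * Xi_metric \<alpha> \<beta> p v (to_sym ?Z, 0)"
    by (simp add: Xi_metric_eq Z tr inner_matrix_eq_trace[of ?Z] Zt)
  then have "?Z = 0"
    using g by simp
  then have "?D ** ?Z ** ?D = 0"
    by simp
  moreover have "?D ** ?Z ** ?D = ?X"
    by (simp add: matrix_mul_assoc P) (simp add: matrix_mul_assoc[symmetric] P)
  ultimately have "fst v = 0"
    by (simp add: sym_matrix_eq_iff)
  with x show ?thesis by (simp add: prod_eq_iff)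
qed

text \<open>The solution \<open>\<Gamma>\<close> of the Koszul formula \<open>2 g (\<Gamma> v w) z = \<partial>\<^sub>v g w z + \<partial>\<^sub>w g v z - \<partial>\<^sub>z g v w\<close>.
  For \<open>z = (0, z)\<close> it determines the vector part, for \<open>z = (Z, 0)\<close> the matrix part, whose middle term
  comes from \<open>- \<beta> \<langle>x, Z y\<rangle>\<close>; this term has a trace, and the multiple \<open>c \<langle>x, D y\<rangle>\<close> of \<open>D\<close> compensates for
  that, which forces \<open>c (1 + 2n\<alpha>) = 2\<alpha>\<beta>\<close>. Keeping \<open>c\<close> as a parameter keeps the divisions out of the
  calculations.\<close>

definition Xi_christoffel :: "real \<Rightarrow> real \<Rightarrow> 'n::finite sym_matrix \<times> (real^'n) \<Rightarrow>
    'n sym_matrix \<times> (real^'n) \<Rightarrow> 'n sym_matrix \<times> (real^'n) \<Rightarrow> 'n sym_matrix \<times> (real^'n)" where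
  "Xi_christoffel c \<beta> p v w =
    (symm (- (mpart v ** minv p ** mpart w) - \<beta> *\<^sub>R outer (mpart p *v snd v) (mpart p *v snd w) +
        (c * (snd v \<bullet> (mpart p *v snd w))) *\<^sub>R mpart p),
     (1 / 2) *\<^sub>R (minv p *v (mpart v *v snd w + mpart w *v snd v)))"

text \<open>Under a trace against symmetric matrices, symmetrization can be dropped, because a matrix and its
  transpose have the same trace.\<close>

lemma trace_symm_mult:
  assumes "transpose A = A"
  shows "trace (A ** of_sym (symm B)) = trace (A ** B)"
proof -
  have "trace (A ** transpose B) = trace (A ** B)"
    by (metis assms matrix_transpose_mul trace_mul_sym trace_transpose transpose_transpose)
  then show ?thesis
    by (simp add: of_sym_symm matrix_linear_simps)
qed

lemma trace_symm_sandwich: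
  assumes P: "transpose P = P" and Z: "transpose Z = Z"
  shows "trace (P ** of_sym (symm B) ** P ** Z) = trace (P ** B ** P ** Z)"
proof -
  have "trace (P ** transpose B ** P ** Z) = trace (Z ** P ** B ** P)"
    using trace_transpose[of "P ** transpose B ** P ** Z"]
    by (simp add: matrix_transpose_mul P Z matrix_mul_assoc)
  also have "\<dots> = trace (P ** B ** P ** Z)"
    using trace_mul_sym[of Z "P ** B ** P"] by (simp add: matrix_mul_assoc)
  finally show ?thesis
    by (simp add: of_sym_symm matrix_linear_simps)
qed

text \<open>Lowering an index of \<open>\<Gamma>\<close>: the condition on \<open>c\<close> is exactly what cancels the terms with
  \<open>\<langle>x, D y\<rangle> Tr (D\<^sup>-\<^sup>1 Z)\<close>.\<close>

lemma Xi_metric_christoffel: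
  fixes p v w z :: "'n::finite sym_matrix \<times> (real^'n)"
  assumes p: "p \<in> Xi" and c: "c * (1 + 2 * real CARD('n) * \<alpha>) = 2 * \<alpha> * \<beta>"
  shows "Xi_metric \<alpha> \<beta> p (Xi_christoffel c \<beta> p v w) z =
    - (1 / 2) * trace (minv p ** mpart v ** minv p ** mpart w ** minv p ** mpart z)
    - \<alpha> * trace (minv p ** mpart v ** minv p ** mpart w) * trace (minv p ** mpart z)
    + \<beta> / 2 * ((mpart v *v snd w + mpart w *v snd v) \<bullet> snd z - snd v \<bullet> (mpart z *v snd w))"
proof -
  note P = Xi_minv[OF p]
  let ?A = "- (mpart v ** minv p ** mpart w) - \<beta> *\<^sub>R outer (mpart p *v snd v) (mpart p *v snd w) +
        (c * (snd v \<bullet> (mpart p *v snd w))) *\<^sub>R mpart p"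
  let ?k = "snd v \<bullet> (mpart p *v snd w)" and ?t = "trace (minv p ** mpart z)"
  have 1: "trace (minv p ** of_sym (symm ?A) ** minv p ** mpart z) =
      - trace (minv p ** mpart v ** minv p ** mpart w ** minv p ** mpart z)
      - \<beta> * (snd v \<bullet> (mpart z *v snd w)) + c * ?k * ?t"
    by (simp add: trace_symm_sandwich P matrix_linear_simps matrix_mult_outer outer_mult_matrix trace_outer)
  have 2: "trace (minv p ** of_sym (symm ?A)) =
      - trace (minv p ** mpart v ** minv p ** mpart w) - \<beta> * ?k + c * ?k * real CARD('n)"
    by (simp add: trace_symm_mult P matrix_linear_simps matrix_mult_outer trace_outer trace_I)
  have 3: "(minv p *v a) \<bullet> (mpart p *v b) = a \<bullet> b" for a b
    by (simp add: inner_symmetric_matrix_vector P)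
  have 4: "1 / 2 * (- T - \<beta> * B + c * k * t) + \<alpha> * (- E - \<beta> * k + c * k * real CARD('n)) * t + \<beta> * (1 / 2 * F) =
      - (1 / 2) * T - \<alpha> * E * t + \<beta> / 2 * (F - B)" for T B E F k t
  proof -
    have "1 / 2 * (- T - \<beta> * B + c * k * t) + \<alpha> * (- E - \<beta> * k + c * k * real CARD('n)) * t + \<beta> * (1 / 2 * F) =
        - (1 / 2) * T - \<alpha> * E * t + \<beta> / 2 * (F - B) +
        k * t / 2 * (c * (1 + 2 * real CARD('n) * \<alpha>) - 2 * \<alpha> * \<beta>)"
      by (simp add: field_simps)
    then show ?thesis using c by simp
  qed
  show ?thesis
    unfolding Xi_metric_eq Xi_christoffel_def fst_conv snd_conv 1 2 inner_scaleR_left 3 by (rule 4)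
qed

lemma bilinear_Xi_christoffel: "bilinear (Xi_christoffel c \<beta> p)"
proof -
  note symm = linear_add[OF bounded_linear.linear[OF bounded_linear_symm]]
    linear_diff[OF bounded_linear.linear[OF bounded_linear_symm]]
    linear_neg[OF bounded_linear.linear[OF bounded_linear_symm]]
    linear_scale[OF bounded_linear.linear[OF bounded_linear_symm]]
  note outer = bounded_bilinear.add_left[OF bounded_bilinear_outer]
    bounded_bilinear.add_right[OF bounded_bilinear_outer]
    bounded_bilinear.scaleR_left[OF bounded_bilinear_outer]
    bounded_bilinear.scaleR_right[OF bounded_bilinear_outer]
  show ?thesis
    unfolding bilinear_def Xi_christoffel_def
    by (auto intro!: linearI simp: matrix_linear_simps outer symm algebra_simps inner_add_left
        inner_add_right scaleR_matrix_vector_assoc[symmetric])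
qed

lemma symm_transpose: "symm (transpose A) = symm A"
  by (simp add: sym_matrix_eq_iff of_sym_symm add.commute)

lemma Xi_christoffel_sym:
  assumes "p \<in> Xi"
  shows "Xi_christoffel c \<beta> p v w = Xi_christoffel c \<beta> p w v"
proof -
  note P = Xi_minv[OF assms]
  have "transpose (- (mpart v ** minv p ** mpart w) - \<beta> *\<^sub>R outer (mpart p *v snd v) (mpart p *v snd w) +
        (c * (snd v \<bullet> (mpart p *v snd w))) *\<^sub>R mpart p) =
      - (mpart w ** minv p ** mpart v) - \<beta> *\<^sub>R outer (mpart p *v snd w) (mpart p *v snd v) +
        (c * (snd w \<bullet> (mpart p *v snd v))) *\<^sub>R mpart p"
    by (simp add: transpose_minus transpose_diff transpose_add transpose_scalar transpose_outer
        matrix_transpose_mul P matrix_mul_assoc inner_symmetric_matrix_vector[of "mpart p" "snd v"]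
        inner_commute[of "snd w"])
  then show ?thesis
    unfolding Xi_christoffel_def by (metis symm_transpose add.commute)
qed

lemma bounded_linear_mpart: "bounded_linear mpart"
  by (intro bounded_linear_compose[OF bounded_linear_of_sym bounded_linear_fst])

lemma smooth_on_minv: "smooth_on minv Xi"
  by (intro smooth_on_matrix_inv open_Xi smooth_on_bounded_linear[OF bounded_linear_mpart]
      smooth_on_ident) (auto simp: Xi_def intro: pos_def_invertible)

lemma smooth_on_Pair:
  assumes S: "open S" and f: "smooth_on f S" and g: "smooth_on g S"
  shows "smooth_on (\<lambda>p. (f p, g p)) S"
proof -
  have "bounded_linear (\<lambda>x. (x, 0))" "bounded_linear (Pair 0)"
    by (auto intro: bounded_linear_intros)
  then have "smooth_on (\<lambda>p. (f p, 0) + (0, g p)) S"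
    by (intro smooth_on_add[OF S]) (auto intro: smooth_on_bounded_linear S f g)
  then show ?thesis by simp
qed

lemma smooth_on_Xi_christoffel:
  assumes v: "smooth_on v Xi" and w: "smooth_on w Xi"
  shows "smooth_on (\<lambda>p. Xi_christoffel c \<beta> p (v p) (w p)) Xi"
proof -
  note S = open_Xi
  note mm = smooth_on_bounded_bilinear[OF bounded_bilinear_matrix_mult S]
  note mv = smooth_on_bounded_bilinear[OF bounded_bilinear_matrix_vector_mult S]
  note sc = smooth_on_bounded_bilinear[OF bounded_bilinear_scaleR S]
  have M: "smooth_on (\<lambda>p. mpart (v p)) Xi" "smooth_on (\<lambda>p. mpart (w p)) Xi" "smooth_on mpart Xi"
    by (intro smooth_on_bounded_linear[OF bounded_linear_mpart S] v w smooth_on_ident)+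
  have s: "smooth_on (\<lambda>p. snd (v p)) Xi" "smooth_on (\<lambda>p. snd (w p)) Xi"
    by (intro smooth_on_bounded_linear[OF bounded_linear_snd S] v w)+
  have inn: "smooth_on (\<lambda>p. snd (v p) \<bullet> (mpart p *v snd (w p))) Xi"
    by (intro smooth_on_bounded_bilinear[OF bounded_bilinear_inner S] mv M s)
  have out: "smooth_on (\<lambda>p. outer (mpart p *v snd (v p)) (mpart p *v snd (w p))) Xi"
    by (intro smooth_on_bounded_bilinear[OF bounded_bilinear_outer S] mv M s)
  have prod: "smooth_on (\<lambda>p. mpart (v p) ** minv p ** mpart (w p)) Xi"
    by (intro mm M smooth_on_minv)
  have "smooth_on (\<lambda>p. - (mpart (v p) ** minv p ** mpart (w p)) +
      (- \<beta>) *\<^sub>R outer (mpart p *v snd (v p)) (mpart p *v snd (w p)) +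
      (snd (v p) \<bullet> (mpart p *v snd (w p))) *\<^sub>R (c *\<^sub>R mpart p)) Xi"
    by (intro smooth_on_add[OF S] sc inn smooth_on_bounded_linear[OF bounded_linear_scaleR_right S]
        smooth_on_bounded_linear[OF bounded_linear_minus[OF bounded_linear_ident] S] prod M out)
  then have "smooth_on (\<lambda>p. symm (- (mpart (v p) ** minv p ** mpart (w p)) +
      (- \<beta>) *\<^sub>R outer (mpart p *v snd (v p)) (mpart p *v snd (w p)) +
      (snd (v p) \<bullet> (mpart p *v snd (w p))) *\<^sub>R (c *\<^sub>R mpart p))) Xi"
    by (rule smooth_on_bounded_linear[OF bounded_linear_symm S])
  moreover have "smooth_on (\<lambda>p. (1 / 2) *\<^sub>R (minv p *v (mpart (v p) *v snd (w p) + mpart (w p) *v snd (v p)))) Xi"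
    by (intro smooth_on_bounded_linear[OF bounded_linear_scaleR_right S] mv smooth_on_minv
        smooth_on_add[OF S] M s)
  ultimately show ?thesis
    unfolding Xi_christoffel_def by (intro smooth_on_Pair[OF S]) (simp_all add: mult.commute)
qed

lemma has_derivative_minv:
  assumes "p \<in> Xi"
  shows "(minv has_derivative (\<lambda>h. - (minv p ** mpart h ** minv p))) (at p)"
  using assms
  by (intro has_derivative_compose[OF bounded_linear_imp_has_derivative[OF bounded_linear_mpart]
        has_derivative_matrix_inv]) (auto simp: Xi_def intro: pos_def_invertible)

text \<open>Compatibility with the metric. The derivative of the metric itself consists of the two lowered
  Christoffel symbols, where the \<open>\<beta>\<close> terms that do not occur in it cancel by the symmetry of the matrices.\<close>

lemma Xi_metric_has_derivative:
  fixes p :: "'n::finite sym_matrix \<times> (real^'n)"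
  assumes p: "p \<in> Xi" and c: "c * (1 + 2 * real CARD('n) * \<alpha>) = 2 * \<alpha> * \<beta>"
    and v: "(v has_derivative v') (at p)" and w: "(w has_derivative w') (at p)"
  shows "((\<lambda>q. Xi_metric \<alpha> \<beta> q (v q) (w q)) has_derivative
    (\<lambda>h. Xi_metric \<alpha> \<beta> p (v' h + Xi_christoffel c \<beta> p h (v p)) (w p) +
         Xi_metric \<alpha> \<beta> p (v p) (w' h + Xi_christoffel c \<beta> p h (w p)))) (at p)"
proof -
  note mm = bounded_bilinear.FDERIV[OF bounded_bilinear_matrix_mult]
  note mv = bounded_bilinear.FDERIV[OF bounded_bilinear_matrix_vector_mult]
  note tr = bounded_linear.has_derivative[OF bounded_linear_trace]
  note M = bounded_linear.has_derivative[OF bounded_linear_mpart v]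
    bounded_linear.has_derivative[OF bounded_linear_mpart w]
  note s = bounded_linear.has_derivative[OF bounded_linear_snd v]
    bounded_linear.has_derivative[OF bounded_linear_snd w]
  note P = has_derivative_minv[OF p]
  note D = bounded_linear_imp_has_derivative[OF bounded_linear_mpart]
  have key: "Xi_metric \<alpha> \<beta> p (v' h + Xi_christoffel c \<beta> p h (v p)) (w p) +
      Xi_metric \<alpha> \<beta> p (v p) (w' h + Xi_christoffel c \<beta> p h (w p)) =
    1 / 2 * (trace (minv p ** mpart (v' h) ** minv p ** mpart (w p)) -
        trace (minv p ** mpart h ** minv p ** mpart (v p) ** minv p ** mpart (w p)) +
        (trace (minv p ** mpart (v p) ** minv p ** mpart (w' h)) -
        trace (minv p ** mpart (v p) ** minv p ** mpart h ** minv p ** mpart (w p)))) +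
    \<alpha> * ((trace (minv p ** mpart (v' h)) - trace (minv p ** mpart h ** minv p ** mpart (v p))) *
          trace (minv p ** mpart (w p)) +
        trace (minv p ** mpart (v p)) *
          (trace (minv p ** mpart (w' h)) - trace (minv p ** mpart h ** minv p ** mpart (w p)))) +
    \<beta> * (snd (v' h) \<bullet> (mpart p *v snd (w p)) + snd (v p) \<bullet> (mpart h *v snd (w p)) +
        snd (v p) \<bullet> (mpart p *v snd (w' h)))" for h
  proof -
    (* The two cubic traces agree up to a cyclic permutation, although the two Christoffel symbols
       contain the factors in a different order. *)
    have cyc: "trace (minv p ** mpart h ** minv p ** mpart (w p) ** minv p ** mpart (v p)) =
        trace (minv p ** mpart (v p) ** minv p ** mpart h ** minv p ** mpart (w p))"
      using trace_mul_sym[of "minv p ** mpart h ** minv p ** mpart (w p)" "minv p ** mpart (v p)"]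
      by (simp add: matrix_mul_assoc)
    have sym: "(mpart a *v x) \<bullet> y = x \<bullet> (mpart a *v y)" for a :: "'n sym_matrix \<times> (real^'n)" and x y
      by (simp add: inner_symmetric_matrix_vector)
    have comm: "snd (w p) \<bullet> (mpart h *v snd (v p)) = snd (v p) \<bullet> (mpart h *v snd (w p))"
      "snd (v p) \<bullet> (mpart (w p) *v snd h) = snd h \<bullet> (mpart (w p) *v snd (v p))"
      "snd (w p) \<bullet> (mpart (v p) *v snd h) = snd h \<bullet> (mpart (v p) *v snd (w p))"
      by (metis sym inner_commute)+
    show ?thesis
      unfolding bilinear_ladd[OF bilinear_Xi_metric] bilinear_radd[OF bilinear_Xi_metric]
        Xi_metric_christoffel[OF p c] Xi_metric_sym[of \<alpha> \<beta> p "v p" "Xi_christoffel c \<beta> p h (w p)"]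
      unfolding Xi_metric_eq cyc
      by (simp add: inner_add_left sym comm field_simps)
  qed
  note quadratic = tr[OF mm[OF mm[OF mm[OF P M(1)] P] M(2)]]
  note traces = has_derivative_mult[OF has_derivative_mult_right[OF tr[OF mm[OF P M(1)]], of \<alpha>] tr[OF mm[OF P M(2)]]]
  note vectors = has_derivative_inner[OF s(1) mv[OF D s(2)]]
  show ?thesis
    unfolding key
    unfolding Xi_metric_eq
    by (rule has_derivative_eq_rhs[OF has_derivative_add[OF has_derivative_add
          [OF has_derivative_mult_right[OF quadratic] traces] has_derivative_mult_right[OF vectors]]])
      (simp add: fun_eq_iff matrix_linear_simps algebra_simps inner_add_right)
qed

lemma levi_civita_chart_Xi:
  assumes \<alpha>: "1 + 2 * real CARD('n) * \<alpha> \<noteq> 0" and \<beta>: "\<beta> \<noteq> 0"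
    and c: "c * (1 + 2 * real CARD('n) * \<alpha>) = 2 * \<alpha> * \<beta>"
  shows "levi_civita_chart (Xi :: ('n::finite sym_matrix \<times> (real^'n)) set)
    (Xi_metric \<alpha> \<beta>) (Xi_christoffel c \<beta>)"
proof
  fix p v w :: "'n sym_matrix \<times> (real^'n)" assume p: "p \<in> Xi"
  show "bilinear (Xi_metric \<alpha> \<beta> p)" "bilinear (Xi_christoffel c \<beta> p)"
    by (rule bilinear_Xi_metric bilinear_Xi_christoffel)+
  show "Xi_metric \<alpha> \<beta> p v w = Xi_metric \<alpha> \<beta> p w v"
    by (rule Xi_metric_sym)
  show "Xi_christoffel c \<beta> p v w = Xi_christoffel c \<beta> p w v"
    by (rule Xi_christoffel_sym[OF p])
  show "v = 0" if "\<And>w. Xi_metric \<alpha> \<beta> p v w = 0"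
    by (rule Xi_metric_nondegenerate[OF p \<alpha> \<beta> that])
qed (simp_all add: open_Xi smooth_on_Xi_christoffel Xi_metric_has_derivative c)

section \<open>The Ricci tensor\<close>

text \<open>The derivative of the Christoffel symbols at \<open>p\<close> in the direction \<open>h\<close>. It depends on the matrix part
  of \<open>h\<close> only.\<close>

definition Xi_christoffel_deriv :: "real \<Rightarrow> real \<Rightarrow> 'n::finite sym_matrix \<times> (real^'n) \<Rightarrow>
    'n sym_matrix \<times> (real^'n) \<Rightarrow> 'n sym_matrix \<times> (real^'n) \<Rightarrow> 'n sym_matrix \<times> (real^'n) \<Rightarrow>
    'n sym_matrix \<times> (real^'n)" where
  "Xi_christoffel_deriv c \<beta> p h v w =
    (symm (mpart v ** minv p ** mpart h ** minv p ** mpart w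
        - \<beta> *\<^sub>R (outer (mpart h *v snd v) (mpart p *v snd w) + outer (mpart p *v snd v) (mpart h *v snd w))
        + (c * (snd v \<bullet> (mpart h *v snd w))) *\<^sub>R mpart p + (c * (snd v \<bullet> (mpart p *v snd w))) *\<^sub>R mpart h),
     - (1 / 2) *\<^sub>R (minv p *v (mpart h *v (minv p *v (mpart v *v snd w + mpart w *v snd v)))))"

lemma Xi_christoffel_has_derivative:
  assumes p: "p \<in> Xi"
  shows "((\<lambda>q. Xi_christoffel c \<beta> q v w) has_derivative
    (\<lambda>h. Xi_christoffel_deriv c \<beta> p h v w)) (at p)"
proof -
  note mm = bounded_bilinear.FDERIV[OF bounded_bilinear_matrix_mult]
  note mv = bounded_bilinear.FDERIV[OF bounded_bilinear_matrix_vector_mult]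
  note P = has_derivative_minv[OF p]
  note D = bounded_linear_imp_has_derivative[OF bounded_linear_mpart]
  note product = mm[OF mm[OF has_derivative_const[of "mpart v"] P] has_derivative_const[of "mpart w"]]
  note Dv = mv[OF D has_derivative_const[of "snd v"]] and Dw = mv[OF D has_derivative_const[of "snd w"]]
  note tensor = bounded_bilinear.FDERIV[OF bounded_bilinear_outer Dv Dw]
  note scalar = has_derivative_mult_right[OF has_derivative_inner[OF has_derivative_const[of "snd v"] Dw], of c]
  note first = bounded_linear.has_derivative[OF bounded_linear_symm
      has_derivative_add[OF has_derivative_diff[OF has_derivative_minus[OF product]
          has_derivative_scaleR_right[OF tensor, of \<beta>]] has_derivative_scaleR[OF scalar D]]]
  note second = has_derivative_scaleR_right[OF mv[OF P
      has_derivative_const[of "mpart v *v snd w + mpart w *v snd v"]], of "1 / 2"]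
  show ?thesis
    unfolding Xi_christoffel_def Xi_christoffel_deriv_def
    by (rule has_derivative_eq_rhs[OF has_derivative_Pair[OF first second]])
      (simp add: fun_eq_iff matrix_linear_simps matrix_minus_vector matrix_vector_mul_assoc algebra_simps
        bounded_bilinear.zero_left[OF bounded_bilinear_outer])
qed

lemma linear_trace_add: "linear_trace (\<lambda>z. f z + g z) = linear_trace f + linear_trace g"
  by (simp add: linear_trace_def inner_add_left sum.distrib)

lemma linear_trace_diff: "linear_trace (\<lambda>z. f z - g z) = linear_trace f - linear_trace g"
  by (simp add: linear_trace_def inner_diff_left sum_subtractf)

lemma sum_Basis_sym_matrix_left:
  fixes B :: "real^'n^'n"
  shows "(\<Sum>b\<in>Basis. (of_sym b ** B) \<bullet> of_sym b) = (real CARD('n) + 1) / 2 * trace B"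
proof -
  have "mat 1 \<bullet> B = trace B"
    by (simp add: inner_matrix_eq_trace trace_transpose)
  then show ?thesis
    using sum_Basis_sym_matrix_sandwich[of "mat 1" B] by (simp add: trace_I algebra_simps)
qed

lemma sum_Basis_sym_matrix_right:
  fixes A :: "real^'n^'n"
  shows "(\<Sum>b\<in>Basis. (A ** of_sym b) \<bullet> of_sym b) = (real CARD('n) + 1) / 2 * trace A"
  using sum_Basis_sym_matrix_sandwich[of A "mat 1"]
  by (simp add: trace_I algebra_simps inner_matrix_eq_trace)

lemma sum_Basis_sym_matrix_id:
  "(\<Sum>b\<in>Basis. of_sym b \<bullet> of_sym (b :: 'n::finite sym_matrix)) =
    real CARD('n) * (real CARD('n) + 1) / 2"
  using sum_Basis_sym_matrix_left[of "mat 1 :: real^'n^'n"] by (simp add: trace_I)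

lemma sum_Basis_sym_matrix_outer_left:
  fixes x y :: "real^'n"
  shows "(\<Sum>b\<in>Basis. outer (of_sym b *v x) y \<bullet> of_sym b) = (real CARD('n) + 1) / 2 * (x \<bullet> y)"
  using sum_Basis_sym_matrix_left[of "outer x y"] by (simp add: matrix_mult_outer trace_outer)

lemma sum_Basis_sym_matrix_outer_right:
  fixes x y :: "real^'n"
  shows "(\<Sum>b\<in>Basis. outer x (of_sym b *v y) \<bullet> of_sym b) = (real CARD('n) + 1) / 2 * (x \<bullet> y)"
  using sum_Basis_sym_matrix_right[of "outer x y"] by (simp add: outer_mult_matrix trace_outer)

lemma sum_Basis_sym_matrix_form:
  fixes x y :: "real^'n"
  shows "(\<Sum>b\<in>Basis. (x \<bullet> (of_sym b *v y)) * (of_sym D \<bullet> of_sym b)) = x \<bullet> (of_sym D *v y)"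
proof -
  have "linear (\<lambda>A :: 'n sym_matrix. x \<bullet> (of_sym A *v y))"
    by (intro linearI) (simp_all add: algebra_simps inner_add_right scaleR_matrix_vector_assoc[symmetric])
  from linear_sum[OF this, of "\<lambda>b. (D \<bullet> b) *\<^sub>R b" Basis]
  show ?thesis
    unfolding euclidean_representation
    by (simp add: inner_sym_matrix_def scaleR_matrix_vector_assoc[symmetric] mult.commute)
qed

text \<open>This is the derivative of \<open>- (n / 2) log det D\<close> in the direction \<open>w\<close>, the logarithm of the volume density
  of the metric up to an additive constant.\<close>

lemma trace_Xi_christoffel:
  fixes w :: "'n::finite sym_matrix \<times> (real^'n)"
  shows "linear_trace (\<lambda>z. Xi_christoffel c \<beta> p z w) =
    - real CARD('n) / 2 * trace (minv p ** mpart w)"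
proof -
  have "trace (mpart w ** minv p) = trace (minv p ** mpart w)"
    by (rule trace_mul_sym)
  moreover have "fst (Xi_christoffel c \<beta> p (b, 0) w) \<bullet> b =
      - ((of_sym b ** (minv p ** mpart w)) \<bullet> of_sym b)" for b
    by (simp add: Xi_christoffel_def inner_symm matrix_mul_assoc
        bounded_bilinear.zero_left[OF bounded_bilinear_outer])
  moreover have "snd (Xi_christoffel c \<beta> p (0, e) w) \<bullet> e =
      1 / 2 * (((minv p ** mpart w) *v e) \<bullet> e)" for e
    by (simp add: Xi_christoffel_def matrix_vector_mul_assoc)
  ultimately show ?thesis
    by (simp only: linear_trace_prod sum_negf sum_distrib_left[symmetric]
        sum_Basis_sym_matrix_left sum_Basis_matrix_vector_inner) (simp add: field_simps)
qed

lemma trace_Xi_christoffel_deriv_arg: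
  fixes v w :: "'n::finite sym_matrix \<times> (real^'n)"
  shows "linear_trace (\<lambda>z. Xi_christoffel_deriv c \<beta> p v z w) =
    real CARD('n) / 2 * trace (minv p ** mpart v ** minv p ** mpart w)"
proof -
  have "fst (Xi_christoffel_deriv c \<beta> p v (b, 0) w) \<bullet> b =
      (of_sym b ** (minv p ** mpart v ** minv p ** mpart w)) \<bullet> of_sym b" for b
    by (simp add: Xi_christoffel_deriv_def inner_symm matrix_mul_assoc
        bounded_bilinear.zero_left[OF bounded_bilinear_outer])
  moreover have "snd (Xi_christoffel_deriv c \<beta> p v (0, e) w) \<bullet> e =
      - (1 / 2) * (((minv p ** mpart v ** minv p ** mpart w) *v e) \<bullet> e)" for e
    by (simp add: Xi_christoffel_deriv_def matrix_vector_mul_assoc matrix_mul_assoc)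
  ultimately show ?thesis
    by (simp only: linear_trace_prod sum_distrib_left[symmetric]
        sum_Basis_sym_matrix_left sum_Basis_matrix_vector_inner) (simp add: field_simps)
qed

text \<open>The vector part of the tangent space contributes nothing here, since \<open>\<Gamma>\<close> does not depend on \<open>u\<close>.\<close>

lemma divergence_Xi_christoffel:
  fixes p v w :: "'n::finite sym_matrix \<times> (real^'n)"
  assumes p: "p \<in> Xi"
  shows "linear_trace (\<lambda>z. Xi_christoffel_deriv c \<beta> p z v w) =
    1 / 2 * trace (minv p ** mpart v) * trace (minv p ** mpart w)
    + 1 / 2 * trace (minv p ** mpart v ** minv p ** mpart w)
    + (c * (1 + real CARD('n) * (real CARD('n) + 1) / 2) - \<beta> * (real CARD('n) + 1)) *
      (snd v \<bullet> (mpart p *v snd w))"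
proof -
  note P = Xi_minv[OF p]
  let ?k = "snd v \<bullet> (mpart p *v snd w)"
  have "fst (Xi_christoffel_deriv c \<beta> p (b, 0) v w) \<bullet> b =
      ((mpart v ** minv p) ** of_sym b ** (minv p ** mpart w)) \<bullet> of_sym b
      - \<beta> * (outer (of_sym b *v snd v) (mpart p *v snd w) \<bullet> of_sym b)
      - \<beta> * (outer (mpart p *v snd v) (of_sym b *v snd w) \<bullet> of_sym b)
      + c * ((snd v \<bullet> (of_sym b *v snd w)) * (mpart p \<bullet> of_sym b))
      + c * ?k * (of_sym b \<bullet> of_sym b)" for b
    by (simp add: Xi_christoffel_deriv_def inner_symm matrix_mul_assoc inner_add_left
        inner_diff_left algebra_simps)
  then have "(\<Sum>b\<in>Basis. fst (Xi_christoffel_deriv c \<beta> p (b, 0) v w) \<bullet> b) =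
      (\<Sum>b\<in>Basis. ((mpart v ** minv p) ** of_sym b ** (minv p ** mpart w)) \<bullet> of_sym b)
      - \<beta> * (\<Sum>b\<in>Basis. outer (of_sym b *v snd v) (mpart p *v snd w) \<bullet> of_sym b)
      - \<beta> * (\<Sum>b\<in>Basis. outer (mpart p *v snd v) (of_sym b *v snd w) \<bullet> of_sym b)
      + c * (\<Sum>b\<in>Basis. (snd v \<bullet> (of_sym b *v snd w)) * (mpart p \<bullet> of_sym b))
      + c * ?k * (\<Sum>b\<in>Basis. of_sym b \<bullet> of_sym (b :: 'n sym_matrix))"
    by (simp add: sum.distrib sum_subtractf sum_distrib_left)
  moreover have "(mpart v ** minv p) \<bullet> (minv p ** mpart w) =
      trace (minv p ** mpart v ** minv p ** mpart w)"
    using trace_mul_sym[of "mpart v ** minv p ** mpart w" "minv p"]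
    by (simp add: inner_matrix_eq_trace matrix_transpose_mul P matrix_mul_assoc)
  moreover have "trace (mpart v ** minv p) = trace (minv p ** mpart v)"
    by (rule trace_mul_sym)
  moreover have "(mpart p *v snd v) \<bullet> snd w = ?k"
    by (simp add: inner_symmetric_matrix_vector)
  moreover have "snd (Xi_christoffel_deriv c \<beta> p (0, e) v w) = 0" for e
    by (simp add: Xi_christoffel_deriv_def)
  ultimately show ?thesis
    by (simp only: linear_trace_prod sum_Basis_sym_matrix_sandwich sum_Basis_sym_matrix_outer_left
        sum_Basis_sym_matrix_outer_right sum_Basis_sym_matrix_form sum_Basis_sym_matrix_id
        inner_zero_left sum.neutral_const)
      (simp add: field_simps)
qed

text \<open>The trace of the product of the endomorphisms \<open>\<Gamma> v\<close> and \<open>\<Gamma> w\<close>. The cross terms matter: on symmetric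
  matrices the path through the vector part adds to the trace, and conversely.\<close>

lemma trace_Xi_christoffel_square:
  fixes p v w :: "'n::finite sym_matrix \<times> (real^'n)"
  assumes p: "p \<in> Xi"
  shows "linear_trace (\<lambda>z. Xi_christoffel c \<beta> p v (Xi_christoffel c \<beta> p z w)) =
    (real CARD('n) + 3) / 4 * trace (minv p ** mpart v ** minv p ** mpart w)
    + 1 / 4 * trace (minv p ** mpart v) * trace (minv p ** mpart w)
    + (c - \<beta> * (real CARD('n) + 1) / 2) * (snd v \<bullet> (mpart p *v snd w))"
proof -
  note P = Xi_minv[OF p]
  note zero = bounded_bilinear.zero_left[OF bounded_bilinear_outer]
    linear_0[OF bounded_linear.linear[OF bounded_linear_symm]]
  let ?k = "snd v \<bullet> (mpart p *v snd w)"
  have cyc: "trace (mpart v ** minv p) = trace (minv p ** mpart v)"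
    "trace (mpart v ** minv p ** mpart w ** minv p) = trace (minv p ** mpart v ** minv p ** mpart w)"
    using trace_mul_sym[of "mpart v" "minv p"] trace_mul_sym[of "mpart v ** minv p ** mpart w" "minv p"]
    by (simp_all add: matrix_mul_assoc)
  have inn: "(mpart v ** minv p) \<bullet> (minv p ** mpart w) =
      trace (minv p ** mpart v ** minv p ** mpart w)"
    by (simp add: inner_matrix_eq_trace matrix_transpose_mul P matrix_mul_assoc cyc)
  have k: "(mpart p *v snd v) \<bullet> snd w = ?k" "(mpart p *v snd w) \<bullet> snd v = ?k"
    by (metis inner_symmetric_matrix_vector inner_commute transpose_of_sym)+

  (* For a symmetric direction b the inner symbol has matrix part - (b P Y + Y P b) / 2 and vector
     part P b y / 2; the terms with c and with beta come from the latter. *)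
  have "fst (Xi_christoffel c \<beta> p v (Xi_christoffel c \<beta> p (b, 0) w)) \<bullet> b =
      1 / 2 * (((mpart v ** minv p) ** of_sym b ** (minv p ** mpart w)) \<bullet> of_sym b)
      + 1 / 2 * (((mpart v ** minv p ** mpart w ** minv p) ** of_sym b) \<bullet> of_sym b)
      - \<beta> / 2 * (outer (mpart p *v snd v) (of_sym b *v snd w) \<bullet> of_sym b)
      + c / 2 * ((snd v \<bullet> (of_sym b *v snd w)) * (mpart p \<bullet> of_sym b))" for b
  proof -
    have 1: "of_sym (symm (- (of_sym b ** minv p ** mpart w))) =
        - (1 / 2) *\<^sub>R (of_sym b ** minv p ** mpart w + mpart w ** minv p ** of_sym b)"
      by (simp add: of_sym_symm transpose_minus matrix_transpose_mul P matrix_mul_assoc algebra_simps)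
    have 2: "snd (Xi_christoffel c \<beta> p (b, 0) w) = (1 / 2) *\<^sub>R (minv p *v (of_sym b *v snd w))"
      "fst (Xi_christoffel c \<beta> p (b, 0) w) = symm (- (of_sym b ** minv p ** mpart w))"
      by (simp_all add: Xi_christoffel_def zero)
    show ?thesis
      unfolding Xi_christoffel_def[of c \<beta> p v] 2 1 fst_conv inner_symm
      by (simp add: inner_symm matrix_linear_simps inner_add_left inner_diff_left P
          matrix_vector_mult_scaleR bounded_bilinear.scaleR_right[OF bounded_bilinear_outer]
          field_simps)
  qed
  then have sym_part: "(\<Sum>b\<in>Basis. fst (Xi_christoffel c \<beta> p v (Xi_christoffel c \<beta> p (b, 0) w)) \<bullet> b) =
      1 / 2 * (\<Sum>b\<in>Basis. ((mpart v ** minv p) ** of_sym b ** (minv p ** mpart w)) \<bullet> of_sym b)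
      + 1 / 2 * (\<Sum>b\<in>Basis. ((mpart v ** minv p ** mpart w ** minv p) ** of_sym b) \<bullet> of_sym b)
      - \<beta> / 2 * (\<Sum>b\<in>Basis. outer (mpart p *v snd v) (of_sym b *v snd w) \<bullet> of_sym b)
      + c / 2 * (\<Sum>b\<in>Basis. (snd v \<bullet> (of_sym b *v snd w)) * (mpart p \<bullet> of_sym b))"
    by (simp add: sum.distrib sum_subtractf sum_distrib_left)

  (* For a vector e it has a matrix part as well, which the outer symbol applies to the vector part
     of v. *)
  have "snd (Xi_christoffel c \<beta> p v (Xi_christoffel c \<beta> p (0, e) w)) \<bullet> e =
      1 / 4 * (((minv p ** mpart v ** minv p ** mpart w) *v e) \<bullet> e)
      - \<beta> / 4 * (?k * (e \<bullet> e)) - \<beta> / 4 * (((mpart p *v snd v) \<bullet> e) * (snd w \<bullet> e))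
      + c / 2 * (((mpart p *v snd w) \<bullet> e) * (snd v \<bullet> e))" for e
  proof -
    have inn_e: "snd v \<bullet> (mpart p *v e) = (mpart p *v snd v) \<bullet> e"
      "e \<bullet> (mpart p *v snd w) = (mpart p *v snd w) \<bullet> e"
      "(mpart p *v e) \<bullet> snd v = (mpart p *v snd v) \<bullet> e"
      by (metis inner_symmetric_matrix_vector inner_commute transpose_of_sym)+
    have 1: "of_sym (symm (- (\<beta> *\<^sub>R outer (mpart p *v e) (mpart p *v snd w)) + d *\<^sub>R mpart p)) *v snd v =
        - (\<beta> / 2) *\<^sub>R (?k *\<^sub>R (mpart p *v e) + ((mpart p *v snd v) \<bullet> e) *\<^sub>R (mpart p *v snd w))
        + d *\<^sub>R (mpart p *v snd v)" for d
    proof -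
      have tr: "transpose (- (\<beta> *\<^sub>R outer (mpart p *v e) (mpart p *v snd w)) + d *\<^sub>R mpart p) =
          - (\<beta> *\<^sub>R outer (mpart p *v snd w) (mpart p *v e)) + d *\<^sub>R mpart p"
        by (simp add: transpose_diff transpose_scalar transpose_outer)
      show ?thesis
        unfolding of_sym_symm tr scaleR_matrix_vector_assoc[symmetric]
          matrix_vector_mult_add_rdistrib matrix_minus_vector outer_mult_vector k inn_e
        by (simp add: vec_eq_iff field_simps)
    qed
    have 2: "snd (Xi_christoffel c \<beta> p (0, e) w) = (1 / 2) *\<^sub>R (minv p *v (mpart w *v e))"
      "fst (Xi_christoffel c \<beta> p (0, e) w) = symm (- (\<beta> *\<^sub>R outer (mpart p *v e) (mpart p *v snd w)) +
        (c * (e \<bullet> (mpart p *v snd w))) *\<^sub>R mpart p)"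
      by (simp_all add: Xi_christoffel_def)
    show ?thesis
      unfolding Xi_christoffel_def[of c \<beta> p v] 2 1 snd_conv
      by (simp add: P inn_e matrix_vector_mult_scaleR matrix_vector_mul_assoc matrix_mul_assoc
          algebra_simps inner_add_left inner_diff_left)
  qed
  then have vec_part: "(\<Sum>e\<in>Basis. snd (Xi_christoffel c \<beta> p v (Xi_christoffel c \<beta> p (0, e) w)) \<bullet> e) =
      1 / 4 * (\<Sum>e\<in>Basis. ((minv p ** mpart v ** minv p ** mpart w) *v e) \<bullet> e)
      - \<beta> / 4 * (?k * (\<Sum>e\<in>(Basis :: (real^'n) set). e \<bullet> e))
      - \<beta> / 4 * (\<Sum>e\<in>Basis. ((mpart p *v snd v) \<bullet> e) * (snd w \<bullet> e))
      + c / 2 * (\<Sum>e\<in>Basis. ((mpart p *v snd w) \<bullet> e) * (snd v \<bullet> e))"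
    by (simp add: sum.distrib sum_subtractf sum_distrib_left)
  have card: "(\<Sum>e\<in>(Basis :: (real^'n) set). e \<bullet> e) = real CARD('n)"
    by simp
  show ?thesis
    unfolding linear_trace_prod sym_part vec_part card sum_Basis_sym_matrix_sandwich
      sum_Basis_sym_matrix_right sum_Basis_sym_matrix_outer_right sum_Basis_sym_matrix_form
      sum_Basis_matrix_vector_inner euclidean_inner[symmetric] cyc inn k
    by (simp add: field_simps)
qed

text \<open>With \<open>\<tau>\<close> the trace of \<open>\<Gamma>\<close>, the Ricci tensor is
  \<open>div \<Gamma> v w - \<partial>\<^sub>v \<tau> w + \<tau> (\<Gamma> v w) - Tr (\<Gamma> v \<circ> \<Gamma> w)\<close>. The parts of \<open>\<partial>\<^sub>v \<tau> w\<close> and \<open>\<tau> (\<Gamma> v w)\<close> without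
  \<open>\<langle>x, D y\<rangle>\<close> cancel.\<close>

theorem theorem5p2:
  fixes \<alpha> \<beta> :: real and D X Y :: "'n::finite sym_matrix" and u x y :: "real ^ 'n"
  assumes "\<alpha> \<noteq> - 1 / (2 * real CARD('n))"
    and "\<beta> \<noteq> 0"
    and "(D, u) \<in> Xi"
  shows "ricci_tensor Xi (Xi_metric \<alpha> \<beta>) (D, u) (X, x) (Y, y) =
      - ((real CARD('n) + 1) / 4) * trace (inv_sym D ** of_sym X ** inv_sym D ** of_sym Y)
      + 1 / 4 * trace (inv_sym D ** of_sym X) * trace (inv_sym D ** of_sym Y)
      - \<beta> / (2 * (1 + 2 * real CARD('n) * \<alpha>)) * (x \<bullet> (of_sym D *v y))"
proof -
  define N where "N = 1 + 2 * real CARD('n) * \<alpha>"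
  define c where "c = 2 * \<alpha> * \<beta> / N"
  define p where "p = (D, u)"
  define v where "v = (X, x)"
  define w where "w = (Y, y)"
  have p: "p \<in> Xi"
    using assms(3) by (simp add: p_def)
  have N: "N \<noteq> 0"
    using assms(1) by (auto simp: N_def field_simps)
  then have c: "c * (1 + 2 * real CARD('n) * \<alpha>) = 2 * \<alpha> * \<beta>"
    by (simp add: c_def flip: N_def)
  interpret levi_civita_chart "Xi :: ('n sym_matrix \<times> (real^'n)) set" "Xi_metric \<alpha> \<beta>" "Xi_christoffel c \<beta>"
    using N by (intro levi_civita_chart_Xi assms(2) c) (simp add: N_def)
  let ?\<Gamma> = "Xi_christoffel c \<beta> p" and ?d\<Gamma> = "Xi_christoffel_deriv c \<beta> p"
  have "ricci_tensor Xi (Xi_metric \<alpha> \<beta>) p v w =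
      linear_trace (\<lambda>z. ?d\<Gamma> z v w - ?d\<Gamma> v z w + ?\<Gamma> z (?\<Gamma> v w) - ?\<Gamma> v (?\<Gamma> z w))"
    unfolding ricci_tensor_def
    by (simp add: riemann_tensor_eq[OF p Xi_christoffel_has_derivative[OF p] Xi_christoffel_has_derivative[OF p]])
  also have "\<dots> = linear_trace (\<lambda>z. ?d\<Gamma> z v w) - linear_trace (\<lambda>z. ?d\<Gamma> v z w)
      + linear_trace (\<lambda>z. ?\<Gamma> z (?\<Gamma> v w)) - linear_trace (\<lambda>z. ?\<Gamma> v (?\<Gamma> z w))"
    by (simp only: linear_trace_add linear_trace_diff)
  also have "linear_trace (\<lambda>z. ?\<Gamma> z (?\<Gamma> v w)) = - real CARD('n) / 2 *
      (- trace (minv p ** mpart v ** minv p ** mpart w)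
        + (c * real CARD('n) - \<beta>) * (snd v \<bullet> (mpart p *v snd w)))"
  proof -
    have "trace (minv p ** mpart (?\<Gamma> v w)) =
        - trace (minv p ** mpart v ** minv p ** mpart w)
        + (c * real CARD('n) - \<beta>) * (snd v \<bullet> (mpart p *v snd w))"
      by (simp add: Xi_christoffel_def trace_symm_mult Xi_minv[OF p] matrix_linear_simps
          matrix_mult_outer trace_outer trace_I algebra_simps)
    then show ?thesis by (simp only: trace_Xi_christoffel)
  qed
  also have "linear_trace (\<lambda>z. ?d\<Gamma> z v w) - linear_trace (\<lambda>z. ?d\<Gamma> v z w)
      + - real CARD('n) / 2 * (- trace (minv p ** mpart v ** minv p ** mpart w)
        + (c * real CARD('n) - \<beta>) * (snd v \<bullet> (mpart p *v snd w)))
      - linear_trace (\<lambda>z. ?\<Gamma> v (?\<Gamma> z w)) =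
      - ((real CARD('n) + 1) / 4) * trace (minv p ** mpart v ** minv p ** mpart w)
      + 1 / 4 * trace (minv p ** mpart v) * trace (minv p ** mpart w)
      + (c * real CARD('n) - \<beta>) / 2 * (snd v \<bullet> (mpart p *v snd w))"
    unfolding divergence_Xi_christoffel[OF p] trace_Xi_christoffel_deriv_arg trace_Xi_christoffel_square[OF p]
    by (simp add: field_simps)
  also have "(c * real CARD('n) - \<beta>) / 2 = - \<beta> / (2 * N)"
  proof -
    have "c * real CARD('n) - \<beta> = \<beta> * (2 * real CARD('n) * \<alpha> - N) / N"
      using N by (simp add: c_def field_simps)
    also have "\<dots> = - \<beta> / N"
      by (simp add: N_def)
    finally show ?thesis by simp
  qed
  finally show ?thesis
    by (simp add: p_def v_def w_def N_def)
qed

end
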